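(* Let $0<a,b<1$ and $0<\eta<1$, and for each $N$ let $f=\eta N$ (an integer; $N\to\infty$ along values for which this holds). Let $\mathbf X=\mathbf X^{N}$ be the two-strata persistent gambler's ruin process described in the context, started at a fixed integer $m$ (independent of $N$), and let $\mathcal R'_N,\mathcal V'_N,\mathcal L'_N$ be the numbers of runs, short runs and steps of its meander. Put $$X_N:=\frac1N\Big(\mathcal L'_N-\frac{2-a-b}{(1-a)(1-b)}\mathcal R'_N+\frac{1}{(1-a)(1-b)}\mathcal V'_N\Big).$$ Let $\sigma_1=\sqrt{a+b^2-2ab}$, $\sigma_2=\sqrt{b+a^2-2ab}$, $\kappa_1=\frac{\eta\sigma_1}{1-b}$, $\kappa_2=\frac{(1-\eta)\sigma_2}{1-a}$. Then for every real $t$, $\lim_{N\to\infty}E\{e^{itX_N}\}=\hat\varphi(t)$, where $\hat\varphi(0)=1$ and for $t\neq0$, $\hat\varphi(t)$ is defined by $$\frac{(b\kappa_1\sigma_2+a\kappa_2\sigma_1)\,t}{\hat\varphi(t)}=a\sigma_1\cosh(\kappa_1t)\sinh(\kappa_2t)+b\sigma_2\sinh(\kappa_1t)\cosh(\kappa_2t)+i(b-a)^2\sinh(\kappa_1t)\sinh(\kappa_2t).$$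
   Context: Fix $0<a,b<1$ and integers $1\le f<N$. The gambler's ruin process $(\mathbf X_j)_{j\ge0}$ takes values in $\mathbb Z\cap[-N,N]$, starts at a fixed integer $\mathbf X_0=m$ with $|m|<N$, and has increments $\varepsilon_j=\mathbf X_j-\mathbf X_{j-1}\in\{1,-1\}$ with $P(\varepsilon_1=1)=P(\varepsilon_1=-1)=\frac12$ and, for $j\ge1$, $P(\varepsilon_{j+1}=1\mid\varepsilon_j=1,|\mathbf X_j|=k)=P(\varepsilon_{j+1}=-1\mid\varepsilon_j=-1,|\mathbf X_j|=k)=a_k$ (the direction is reversed with probability $1-a_k$), where $a_k=a$ if $0\le k\le f-1$ and $a_k=b$ if $f\le k<N$. The process is stopped at the first time $j$ with $|\mathbf X_j|=N$. For a nearest-neighbour path $\Gamma_0,\dots,\Gamma_n$ (steps $\Gamma_j-\Gamma_{j-1}=\pm1$), a run is a maximal block of consecutive steps all equal to $+1$ or all equal to $-1$; its length is its number of steps; a short run has length $1$, a long run has length at least $2$. The last visit is $\mathcal L_N:=\max\{j\ge0: j=0\text{ or }\mathbf X_j=0\}$ (over times up to termination), and the meander is the portion of the path from time $\mathcal L_N$ to the termination time. $\mathcal R'_N,\mathcal V'_N,\mathcal L'_N$ denote the number of runs, of short runs, and of steps of the meander path. *)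

theory Defs
  imports "HOL-Analysis.Analysis"
begin

definition step_val :: "bool \<Rightarrow> int" where
  "step_val s = (if s then 1 else -1)"

definition pos :: "int \<Rightarrow> bool list \<Rightarrow> nat \<Rightarrow> int" where
  "pos m ss j = m + (\<Sum>i<j. step_val (ss ! i))"

definition persist :: "real \<Rightarrow> real \<Rightarrow> nat \<Rightarrow> nat \<Rightarrow> real" where
  "persist a b f k = (if k \<le> f - 1 then a else b)"

text \<open>Probability that the stopped process, started at m, follows exactly the
  step sequence ss up to termination (0 if ss is not a terminated path).\<close>
definition path_prob :: "real \<Rightarrow> real \<Rightarrow> nat \<Rightarrow> nat \<Rightarrow> int \<Rightarrow> bool list \<Rightarrow> real" where
  "path_prob a b f N m ss =
     (if ss \<noteq> [] \<and> (\<forall>j<length ss. \<bar>pos m ss j\<bar> < int N) \<and> \<bar>pos m ss (length ss)\<bar> = int N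
      then (1/2) * (\<Prod>j\<in>{1..<length ss}.
              (let \<alpha> = persist a b f (nat \<bar>pos m ss j\<bar>)
               in if ss ! j = ss ! (j - 1) then \<alpha> else 1 - \<alpha>))
      else 0)"

definition last_visit :: "int \<Rightarrow> bool list \<Rightarrow> nat" where
  "last_visit m ss = Max ({0} \<union> {j. j \<le> length ss \<and> pos m ss j = 0})"

definition meander :: "int \<Rightarrow> bool list \<Rightarrow> bool list" where
  "meander m ss = drop (last_visit m ss) ss"

fun runlens :: "bool list \<Rightarrow> nat list" where
  "runlens [] = []"
| "runlens (x # xs) =
     (case xs of [] \<Rightarrow> [1]
      | y # _ \<Rightarrow> (if x = y then Suc (hd (runlens xs)) # tl (runlens xs) else 1 # runlens xs))"

definition num_runs :: "bool list \<Rightarrow> nat" where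
  "num_runs ss = length (runlens ss)"

definition num_short_runs :: "bool list \<Rightarrow> nat" where
  "num_short_runs ss = length (filter (\<lambda>l. l = 1) (runlens ss))"

definition XN :: "real \<Rightarrow> real \<Rightarrow> nat \<Rightarrow> int \<Rightarrow> bool list \<Rightarrow> real" where
  "XN a b N m ss =
     (let ms = meander m ss in
      (real (length ms) - (2 - a - b) / ((1 - a) * (1 - b)) * real (num_runs ms)
        + 1 / ((1 - a) * (1 - b)) * real (num_short_runs ms)) / real N)"

definition charfun_XN :: "real \<Rightarrow> real \<Rightarrow> real \<Rightarrow> int \<Rightarrow> nat \<Rightarrow> real \<Rightarrow> complex" where
  "charfun_XN a b \<eta> m N t =
     (let f = nat \<lfloor>\<eta> * real N\<rfloor> in
      infsum (\<lambda>ss. complex_of_real (path_prob a b f N m ss)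
                     * exp (\<i> * complex_of_real (t * XN a b N m ss))) UNIV)"

definition phi_hat :: "real \<Rightarrow> real \<Rightarrow> real \<Rightarrow> real \<Rightarrow> complex" where
  "phi_hat a b \<eta> t =
     (if t = 0 then 1 else
      (let \<sigma>1 = sqrt (a + b^2 - 2*a*b); \<sigma>2 = sqrt (b + a^2 - 2*a*b);
           \<kappa>1 = \<eta> * \<sigma>1 / (1 - b); \<kappa>2 = (1 - \<eta>) * \<sigma>2 / (1 - a)
       in complex_of_real ((b * \<kappa>1 * \<sigma>2 + a * \<kappa>2 * \<sigma>1) * t) /
          (complex_of_real (a * \<sigma>1 * cosh (\<kappa>1 * t) * sinh (\<kappa>2 * t)
                           + b * \<sigma>2 * sinh (\<kappa>1 * t) * cosh (\<kappa>2 * t))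
           + \<i> * complex_of_real ((b - a)^2 * sinh (\<kappa>1 * t) * sinh (\<kappa>2 * t)))))"

end

theory Submission
  imports Defs "HOL-Real_Asymp.Real_Asymp"
begin

text \<open>Cut every path at its last visit to the origin. By the Markov property and the reflection
  symmetry, the sum of a reflection invariant weight \<open>g\<close> of the meander over the paths that visit the origin is
  a multiple of the excursion sum of \<open>g\<close>, the sum over paths that leave \<open>0\<close> and
  reach \<open>N\<close> without returning, and the factor does not depend on \<open>g\<close>. The paths that never visit the
  origin have probability \<open>O(1 / N)\<close>, so the characteristic function is asymptotically the ratio of the excursion
  sums of \<open>g = exp (i t X)\<close> and of \<open>1\<close>.

  The excursion sum satisfies a linear two-point boundary problem in the site. The coefficients of
  runs and short runs in \<open>X\<close> are such that within a stratum the transfer matrix, after scaling, is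
  \<open>I + G / N + o(1 / N)\<close> with \<open>G\<close> off-diagonal and \<open>G\<^sup>2\<close> a nonnegative scalar. Its powers thus
  converge to hyperbolic functions, and the sites at the interface contribute the imaginary term of the limit.\<close>

section \<open>Sums over terminated paths\<close>

text \<open>Let -c1 and c2 be the coefficients of runs and short runs in X. In a stratum with
  reversal probability q, the order 1 / N part of the lower left transfer entry is a multiple of 1 -
  c1 q + c2 q^2. It has to vanish for q = 1 - a and for q = 1 - b, so the polynomial is (1 - q / (1
  - a)) (1 - q / (1 - b)), which determines c1 and c2. What remains of that entry has order 1 / N^2
  and faces an upper right entry of order 1; rescaling one component by N balances them over a
  distance of order N. A site at the interface has a neighbour in the other stratum, and there the
  cancellation fails at order 1 / N. The last inner site leaves a (a - b) and the first outer site b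
  (b - a), both times i t c2; their sum is the square (a - b)^2 of the limit formula. The obstacle
  is that the state must remember whether the current run is still short. Eliminating the sums for
  long current runs leaves two unknowns per edge, but the coefficients then involve the persistence
  of a neighbouring site. The same limit at t = 0 gives the order of the probability of avoiding the
  origin.\<close>

primrec visits :: "int \<Rightarrow> bool list \<Rightarrow> bool" where
  "visits k [] \<longleftrightarrow> k = 0"
| "visits k (s # ss) \<longleftrightarrow> k = 0 \<or> visits (k + step_val s) ss"

lemma step_val_simps [simp]: "step_val True = 1" "step_val False = -1"
  by (simp_all add: step_val_def)

lemma step_val_Not [simp]: "step_val (\<not> s) = - step_val s"
  by (simp add: step_val_def)

lemma pos_0 [simp]: "pos m ss 0 = m"
  by (simp add: pos_def)

lemma pos_Cons_Suc: "pos m (s # ss) (Suc j) = pos (m + step_val s) ss j"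
  unfolding pos_def by (subst sum.lessThan_Suc_shift) simp

lemma visits_iff: "visits k ss \<longleftrightarrow> (\<exists>j\<le>length ss. pos k ss j = 0)"
proof (induction ss arbitrary: k)
  case (Cons s ss)
  have "(\<exists>j\<le>length (s # ss). pos k (s # ss) j = 0) \<longleftrightarrow>
      k = 0 \<or> (\<exists>j\<le>length ss. pos k (s # ss) (Suc j) = 0)"
    by (metis (no_types, lifting) Suc_le_mono le0 length_Cons not0_implies_Suc pos_0)
  then show ?case using Cons by (simp add: pos_Cons_Suc)
qed auto

text \<open>Either the tail has a zero, and the shift by one commutes with the maximum, or the
  default 0 is the maximum, whether or not the path starts at the origin.\<close>

lemma last_visit_Cons:
  "last_visit m (s # ss) =
     (if visits (m + step_val s) ss then Suc (last_visit (m + step_val s) ss) else 0)"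
proof -
  let ?A = "{j. j \<le> length (s # ss) \<and> pos m (s # ss) j = 0}"
  let ?B = "{j. j \<le> length ss \<and> pos (m + step_val s) ss j = 0}"
  have AB: "?A - {0} = Suc ` ?B"
  proof (intro set_eqI iffI)
    fix x assume "x \<in> ?A - {0}"
    then obtain j where "x = Suc j" "Suc j \<in> ?A" by (cases x) auto
    then show "x \<in> Suc ` ?B" by (auto simp: pos_Cons_Suc)
  qed (auto simp: pos_Cons_Suc)
  have fin: "finite ?B" by simp
  have "{0} \<union> ?A = insert 0 (Suc ` ?B)" using AB by blast
  then have lv: "last_visit m (s # ss) = Max (insert 0 (Suc ` ?B))"
    by (simp add: last_visit_def)
  show ?thesis
  proof (cases "visits (m + step_val s) ss")
    case True
    then have ne: "?B \<noteq> {}" by (auto simp: visits_iff)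
    have "Max (insert 0 (Suc ` ?B)) = Max (Suc ` ?B)"
      using ne fin by (subst Max_insert) auto
    also have "\<dots> = Suc (Max ?B)"
      using mono_Max_commute[of Suc ?B] fin ne by (simp add: mono_def)
    also have "Max ?B = Max ({0} \<union> ?B)"
      using ne fin by (subst Max_Un) auto
    finally show ?thesis using lv True by (simp add: last_visit_def)
  next
    case False
    then have "?B = {}" by (auto simp: visits_iff)
    then show ?thesis unfolding lv using False by (simp only:) simp
  qed
qed

lemma meander_Cons:
  "meander m (s # ss) =
     (if visits (m + step_val s) ss then meander (m + step_val s) ss else s # ss)"
  by (simp add: meander_def last_visit_Cons)

lemma visits_flip: "visits (- k) (map Not ss) = visits k ss"
proof (induction ss arbitrary: k)
  case (Cons s ss)
  show ?case using Cons.IH[of "k + step_val s"] by simp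
qed simp

lemma finite_bool_lists: "finite {ss :: bool list. length ss \<le> n}"
  using finite_lists_length_le[of "UNIV :: bool set" n] by simp

text \<open>Splitting by the first letter is first-step analysis at the level of infinite sums; the
  empty list is the path that has already stopped.\<close>

lemma has_sum_bool_list:
  fixes f :: "bool list \<Rightarrow> 'a::{topological_comm_monoid_add, t2_space}"
  assumes "((\<lambda>ss. f (True # ss)) has_sum x) UNIV" "((\<lambda>ss. f (False # ss)) has_sum y) UNIV"
  shows "(f has_sum (f [] + (x + y))) UNIV"
proof -
  have U: "(UNIV :: bool list set) = {[]} \<union> (range (Cons True) \<union> range (Cons False))"
  proof (intro set_eqI)
    fix ss :: "bool list"
    show "ss \<in> UNIV \<longleftrightarrow> ss \<in> {[]} \<union> (range (Cons True) \<union> range (Cons False))"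
      by (cases ss) (auto simp: image_iff)
  qed
  have inj: "inj (Cons s)" for s :: bool by simp
  have "(f has_sum x) (range (Cons True))" "(f has_sum y) (range (Cons False))"
    using assms by (simp_all add: has_sum_reindex[OF inj] o_def)
  then show ?thesis
    by (subst U) (intro has_sum_Un_disjoint has_sum_finite[of "{[]}" f, simplified]; auto)
qed

section \<open>Weights of a persistent walk stopped at distance N\<close>

locale persistent_walk =
  fixes \<alpha> :: "int \<Rightarrow> real" and N :: nat and \<rho> :: real
  assumes \<rho>_pos: "0 < \<rho>"
    and \<rho>_le: "\<rho> \<le> \<alpha> k" "\<rho> \<le> 1 - \<alpha> k"
    and \<alpha>_sym: "\<alpha> (- k) = \<alpha> k"
begin

definition trans_prob :: "int \<Rightarrow> bool \<Rightarrow> bool \<Rightarrow> real" where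
  "trans_prob k d s = (if s = d then \<alpha> k else 1 - \<alpha> k)"

text \<open>The law of the remaining path given the site \<open>k\<close> and the last direction
  \<open>d\<close>. Only lists that end at the first arrival at distance \<open>N\<close> get
  weight, so no stopping time has to be formalized.\<close>

primrec path_weight :: "int \<Rightarrow> bool \<Rightarrow> bool list \<Rightarrow> real" where
  "path_weight k d [] = (if \<bar>k\<bar> = int N then 1 else 0)"
| "path_weight k d (s # ss) =
     (if \<bar>k\<bar> < int N then trans_prob k d s * path_weight (k + step_val s) s ss else 0)"

text \<open>An expectation over the remaining path. Banach space values let real probabilities and
  complex characteristic functions share one calculus.\<close>

definition path_sum :: "int \<Rightarrow> bool \<Rightarrow> (bool list \<Rightarrow> 'a::banach) \<Rightarrow> 'a" where
  "path_sum k d g = (\<Sum>\<^sub>\<infinity>ss. path_weight k d ss *\<^sub>R g ss)"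

lemma trans_prob_ge: "\<rho> \<le> trans_prob k d s"
  using \<rho>_le by (simp add: trans_prob_def)

lemma trans_prob_pos: "0 < trans_prob k d s"
  using trans_prob_ge[of k d s] \<rho>_pos by linarith

lemma trans_prob_sum: "trans_prob k d True + trans_prob k d False = 1"
  by (auto simp: trans_prob_def)

lemma path_weight_nonneg: "0 \<le> path_weight k d ss"
  by (induction ss arbitrary: k d) (auto intro: mult_nonneg_nonneg less_imp_le[OF trans_prob_pos])

text \<open>The left side is the probability of stopping within \<open>n\<close> steps; conditioning
  on the first step propagates the bound.\<close>

lemma path_weight_bounded: "(\<Sum>ss | length ss \<le> n. path_weight k d ss) \<le> 1"
proof (induction n arbitrary: k d)
  case (Suc n)
  have split: "{ss :: bool list. length ss \<le> Suc n} =
      insert [] (Cons True ` {ss. length ss \<le> n} \<union> Cons False ` {ss. length ss \<le> n})"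
    (is "_ = insert [] (?T \<union> ?F)")
  proof (intro set_eqI)
    fix ss :: "bool list"
    show "ss \<in> {ss. length ss \<le> Suc n} \<longleftrightarrow> ss \<in> insert [] (?T \<union> ?F)"
      by (cases ss) (auto simp: image_iff)
  qed
  have "(\<Sum>ss | length ss \<le> Suc n. path_weight k d ss) = path_weight k d [] +
      ((\<Sum>ss | length ss \<le> n. path_weight k d (True # ss)) + (\<Sum>ss | length ss \<le> n. path_weight k d (False # ss)))"
    unfolding split using finite_bool_lists[of n]
    by (subst sum.insert, force, force, subst sum.union_disjoint)
       (auto simp: sum.reindex)
  also have "\<dots> \<le> 1"
  proof (cases "\<bar>k\<bar> < int N")
    case True
    have "(\<Sum>ss | length ss \<le> n. path_weight k d (s # ss)) \<le> trans_prob k d s" for s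
      using True Suc.IH[of "k + step_val s" s] less_imp_le[OF trans_prob_pos[of k d s]]
      by (simp flip: sum_distrib_left add: mult_left_le)
    from this[of True] this[of False] show ?thesis
      using True trans_prob_sum[of k d] by simp
  qed simp
  finally show ?case .
qed simp

lemma path_weight_summable: "path_weight k d summable_on UNIV"
proof (rule nonneg_bdd_above_summable_on)
  show "bdd_above (sum (path_weight k d) ` {F. F \<subseteq> UNIV \<and> finite F})"
  proof (rule bdd_aboveI2)
    fix F :: "bool list set" assume "F \<in> {F. F \<subseteq> UNIV \<and> finite F}"
    then have F: "finite F" by simp
    have "sum (path_weight k d) F \<le> (\<Sum>ss | length ss \<le> Max (length ` F). path_weight k d ss)"
      using F path_weight_nonneg finite_bool_lists by (intro sum_mono2) auto
    then show "sum (path_weight k d) F \<le> 1" using path_weight_bounded[of k d] by (meson order_trans)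
  qed
qed (rule path_weight_nonneg)

lemma path_sum_abs_summable:
  fixes g :: "bool list \<Rightarrow> 'a::banach"
  assumes "\<And>ss. norm (g ss) \<le> B"
  shows "(\<lambda>ss. norm (path_weight k d ss *\<^sub>R g ss)) summable_on UNIV"
proof (rule summable_on_comparison_test)
  show "(\<lambda>ss. path_weight k d ss * B) summable_on UNIV"
    by (rule summable_on_cmult_left[OF path_weight_summable])
qed (auto intro!: mult_left_mono assms simp: path_weight_nonneg)

lemma path_sum_summable:
  fixes g :: "bool list \<Rightarrow> 'a::banach"
  assumes "\<And>ss. norm (g ss) \<le> B"
  shows "(\<lambda>ss. path_weight k d ss *\<^sub>R g ss) summable_on A"
  by (rule summable_on_subset_banach[OF abs_summable_summable[OF path_sum_abs_summable]])
     (use assms in auto)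

lemma path_sum_cong:
  assumes "\<And>ss. path_weight k d ss \<noteq> 0 \<Longrightarrow> g ss = h ss"
  shows "path_sum k d g = path_sum k d h"
  unfolding path_sum_def by (rule infsum_cong) (use assms in force)

lemma path_sum_zero [simp]: "path_sum k d (\<lambda>_. 0) = 0"
  by (simp add: path_sum_def)

lemma path_sum_mult_left:
  fixes g :: "bool list \<Rightarrow> 'a::{banach, real_normed_div_algebra}"
  shows "path_sum k d (\<lambda>ss. c * g ss) = c * path_sum k d g"
  unfolding path_sum_def by (simp flip: infsum_cmult_right')

lemma path_sum_add:
  fixes g h :: "bool list \<Rightarrow> 'a::banach"
  assumes "\<And>ss. norm (g ss) \<le> B" "\<And>ss. norm (h ss) \<le> C"
  shows "path_sum k d (\<lambda>ss. g ss + h ss) = path_sum k d g + path_sum k d h"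
  unfolding path_sum_def scaleR_add_right
  by (rule infsum_add) (rule path_sum_summable, rule assms)+

lemma path_sum_mono:
  fixes g h :: "bool list \<Rightarrow> real"
  assumes "\<And>ss. norm (g ss) \<le> B" "\<And>ss. norm (h ss) \<le> C" "\<And>ss. g ss \<le> h ss"
  shows "path_sum k d g \<le> path_sum k d h"
  unfolding path_sum_def
  by (rule infsum_mono) (rule path_sum_summable assms scaleR_left_mono path_weight_nonneg)+

lemma path_sum_of_real:
  fixes g :: "bool list \<Rightarrow> real"
  assumes "\<And>ss. norm (g ss) \<le> B"
  shows "path_sum k d (\<lambda>ss. complex_of_real (g ss)) = of_real (path_sum k d g)"
proof -
  have "((\<lambda>ss. path_weight k d ss *\<^sub>R g ss) has_sum path_sum k d g) UNIV"
    unfolding path_sum_def by (rule has_sum_infsum[OF path_sum_summable[OF assms]])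
  from infsumI[OF has_sum_of_real[OF this, where 'a = complex]] show ?thesis
    by (simp add: path_sum_def scaleR_conv_of_real)
qed

lemma norm_path_sum_le:
  fixes g :: "bool list \<Rightarrow> 'a::banach"
  assumes "\<And>ss. norm (g ss) \<le> h ss" "\<And>ss. h ss \<le> B"
  shows "norm (path_sum k d g) \<le> path_sum k d h"
proof -
  have gB: "norm (g ss) \<le> B" for ss using assms order_trans by blast
  have hB: "norm (h ss) \<le> B" for ss
    using assms(1)[of ss] assms(2)[of ss] norm_ge_zero[of "g ss"] by (simp del: norm_ge_zero)
  have "norm (path_sum k d g) \<le> (\<Sum>\<^sub>\<infinity>ss. norm (path_weight k d ss *\<^sub>R g ss))"
    unfolding path_sum_def by (rule norm_infsum_bound[OF path_sum_abs_summable[OF gB]])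
  also have "\<dots> \<le> path_sum k d h"
    unfolding path_sum_def
    by (rule infsum_mono)
       (use path_sum_abs_summable[OF gB] path_sum_summable[OF hB] assms(1)
         in \<open>auto intro!: mult_left_mono simp: path_weight_nonneg\<close>)
  finally show ?thesis .
qed

lemma path_sum_boundary:
  fixes g :: "bool list \<Rightarrow> 'a::banach"
  assumes "\<bar>k\<bar> = int N"
  shows "path_sum k d g = g []"
proof -
  have [simp]: "path_weight k d ss = (if ss = [] then 1 else 0)" for ss
    using assms by (cases ss) auto
  then have "path_sum k d g = (\<Sum>\<^sub>\<infinity>ss\<in>{[]}. g ss)"
    unfolding path_sum_def by (intro infsum_cong_neutral) (auto simp del: path_weight.simps)
  then show ?thesis by simp
qed

lemma path_sum_step:
  fixes g :: "bool list \<Rightarrow> 'a::banach"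
  assumes k: "\<bar>k\<bar> < int N" and B: "\<And>ss. norm (g ss) \<le> B"
  shows "path_sum k d g =
    trans_prob k d True *\<^sub>R path_sum (k + 1) True (\<lambda>ss. g (True # ss)) +
    trans_prob k d False *\<^sub>R path_sum (k - 1) False (\<lambda>ss. g (False # ss))"
proof -
  have "((\<lambda>ss. path_weight k d (s # ss) *\<^sub>R g (s # ss)) has_sum
      trans_prob k d s *\<^sub>R path_sum (k + step_val s) s (\<lambda>ss. g (s # ss))) UNIV" for s
  proof -
    have "((\<lambda>ss. path_weight (k + step_val s) s ss *\<^sub>R g (s # ss)) has_sum
        path_sum (k + step_val s) s (\<lambda>ss. g (s # ss))) UNIV"
      unfolding path_sum_def by (rule has_sum_infsum[OF path_sum_summable[OF B]])
    from has_sum_bounded_linear[OF bounded_linear_scaleR_right this, of "trans_prob k d s"]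
    show ?thesis using k by simp
  qed
  from infsumI[OF has_sum_bool_list[OF this[of True] this[of False]]] k show ?thesis
    by (simp add: path_sum_def)
qed

lemma path_sum_flip:
  fixes g :: "bool list \<Rightarrow> 'a::banach"
  shows "path_sum (- k) (\<not> d) g = path_sum k d (\<lambda>ss. g (map Not ss))"
proof -
  have w: "path_weight (- k) (\<not> d) (map Not ss) = path_weight k d ss" for ss
  proof (induction ss arbitrary: k d)
    case (Cons s ss)
    have "trans_prob (- k) (\<not> d) (\<not> s) = trans_prob k d s"
      by (auto simp: trans_prob_def \<alpha>_sym)
    then show ?case using Cons.IH[of "k + step_val s" s] by simp
  qed simp
  have "bij (map Not)"
    by (rule o_bij[of "map Not"]) (auto simp: fun_eq_iff o_def)
  from infsum_reindex_bij_betw[OF this, of "\<lambda>ss. path_weight (- k) (\<not> d) ss *\<^sub>R g ss"]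
  show ?thesis by (simp add: path_sum_def w)
qed

text \<open>From every state an upward step has probability at least \<open>\<rho>\<close>, so a positive maximum would
  have to shrink by the factor \<open>1 - \<rho> ^ (2 * N)\<close>.\<close>

lemma maximum_principle:
  fixes v :: "int \<Rightarrow> bool \<Rightarrow> real"
  assumes bnd: "\<And>k d. \<bar>k\<bar> = int N \<Longrightarrow> v k d \<le> 0"
    and sub: "\<And>k d. \<bar>k\<bar> < int N \<Longrightarrow>
      v k d \<le> trans_prob k d True * v (k + 1) True + trans_prob k d False * v (k - 1) False"
    and k: "\<bar>k\<bar> \<le> int N"
  shows "v k d \<le> 0"
proof -
  let ?S = "(\<lambda>(k, d). v k d) ` ({- int N..int N} \<times> UNIV)"
  \<comment> \<open>The inserted 0 makes \<open>M\<close> nonnegative, so that weakening the factor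
    \<rho>^j goes in the right direction.\<close>
  define M where "M = Max (insert 0 ?S)"
  have fin: "finite (insert 0 ?S)" by simp
  have le_M: "v k d \<le> M" if "\<bar>k\<bar> \<le> int N" for k d
    unfolding M_def by (rule Max_ge[OF fin]) (use that in \<open>force intro!: rev_image_eqI[of "(k, d)"]\<close>)
  have M0: "0 \<le> M" unfolding M_def by (rule Max_ge[OF fin]) simp
  have \<rho>1: "\<rho> < 1" using \<rho>_pos \<rho>_le[of 0] by linarith
  \<comment> \<open>From this site \<open>j\<close> upward steps in a row reach the boundary. In the
    induction the upper neighbour carries the improved bound and the lower one only the bound
    \<open>M\<close>; the range 2 N covers the whole interval.\<close>
  have down: "v (int N - int j) d \<le> M * (1 - \<rho> ^ j)" if "j \<le> 2 * N" for j d
    using that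
  proof (induction j arbitrary: d)
    case 0
    then show ?case using bnd[of "int N" d] by simp
  next
    case (Suc j)
    let ?k = "int N - int (Suc j)"
    show ?case
    proof (cases "\<bar>?k\<bar> < int N")
      case True
      have up: "v (?k + 1) True \<le> M * (1 - \<rho> ^ j)" using Suc.IH[of True] Suc.prems by simp
      have dn: "v (?k - 1) False \<le> M" using True by (intro le_M) auto
      define p where "p = trans_prob ?k d True"
      have p: "\<rho> \<le> p" "trans_prob ?k d False = 1 - p" "0 \<le> p" "0 \<le> 1 - p"
        using trans_prob_ge[of ?k d True] trans_prob_sum[of ?k d] trans_prob_pos[of ?k d False]
          trans_prob_pos[of ?k d True] by (auto simp: p_def)
      have "v ?k d \<le> p * v (?k + 1) True + (1 - p) * v (?k - 1) False"
        using sub[OF True, of d] p by (simp add: p_def)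
      also have "\<dots> \<le> p * (M * (1 - \<rho> ^ j)) + (1 - p) * M"
        using up dn p by (intro add_mono mult_left_mono)
      also have "\<dots> = M - p * (M * \<rho> ^ j)" by (simp add: algebra_simps)
      also have "\<dots> \<le> M - \<rho> * (M * \<rho> ^ j)"
        using p M0 \<rho>_pos by (intro diff_left_mono mult_right_mono) auto
      finally show ?thesis by (simp add: algebra_simps)
    next
      case False
      then have "\<bar>?k\<bar> = int N" using Suc.prems by auto
      then have "v ?k d \<le> 0" by (rule bnd)
      also have "0 \<le> M * (1 - \<rho> ^ Suc j)"
        using M0 \<rho>_pos \<rho>1 by (intro mult_nonneg_nonneg) (auto simp: power_le_one mult_le_one)
      finally show ?thesis .
    qed
  qed
  have "M \<le> M * (1 - \<rho> ^ (2 * N))"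
  proof -
    have "M \<in> insert 0 ?S" unfolding M_def by (rule Max_in[OF fin]) simp
    show ?thesis
    proof (cases "M = 0")
      case False
      with \<open>M \<in> insert 0 ?S\<close> obtain k d where 2: "k \<in> {- int N..int N}" "M = v k d" by auto
      define j where "j = nat (int N - k)"
      have j: "j \<le> 2 * N" "k = int N - int j" using 2 by (auto simp: j_def)
      have "M \<le> M * (1 - \<rho> ^ j)" using down[OF j(1), of d] 2 j by simp
      also have "\<dots> \<le> M * (1 - \<rho> ^ (2 * N))"
        using j \<rho>_pos \<rho>1 M0 by (intro mult_left_mono) (auto intro: power_decreasing)
      finally show ?thesis .
    qed simp
  qed
  then have "M * \<rho> ^ (2 * N) \<le> 0" by (simp add: algebra_simps)
  then have "M \<le> 0"
    using zero_less_power[OF \<rho>_pos, of "2 * N"] by (simp add: mult_le_0_iff)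
  then show ?thesis using le_M[OF k, of d] by linarith
qed

text \<open>By the triangle inequality the norm of a harmonic function is subharmonic. The result is
  uniqueness for the boundary value problem.\<close>

lemma maximum_principle_norm:
  fixes v :: "int \<Rightarrow> bool \<Rightarrow> 'a::banach"
  assumes bnd: "\<And>k d. \<bar>k\<bar> = int N \<Longrightarrow> v k d = 0"
    and sub: "\<And>k d. \<bar>k\<bar> < int N \<Longrightarrow>
      v k d = trans_prob k d True *\<^sub>R v (k + 1) True + trans_prob k d False *\<^sub>R v (k - 1) False"
    and k: "\<bar>k\<bar> \<le> int N"
  shows "v k d = 0"
proof -
  have "norm (v k d) \<le> 0"
  proof (rule maximum_principle[OF _ _ k, of "\<lambda>k d. norm (v k d)"])
    fix k d assume "\<bar>k\<bar> < int N"
    from sub[OF this, of d] show "norm (v k d) \<le>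
      trans_prob k d True * norm (v (k + 1) True) + trans_prob k d False * norm (v (k - 1) False)"
      using trans_prob_pos[of k d True] trans_prob_pos[of k d False]
      by (metis (no_types, lifting) abs_of_pos norm_scaleR norm_triangle_ineq)
  qed (simp add: bnd)
  then show ?thesis by simp
qed

text \<open>Almost sure termination without a tail estimate: the defect from 1 is harmonic and
  vanishes at distance \<open>N\<close>.\<close>

lemma total_mass: "\<bar>k\<bar> \<le> int N \<Longrightarrow> path_sum k d (\<lambda>_. 1 :: real) = 1"
proof -
  assume k: "\<bar>k\<bar> \<le> int N"
  have "path_sum k d (\<lambda>_. 1 :: real) - 1 = 0"
  proof (rule maximum_principle_norm[OF _ _ k, of "\<lambda>k d. path_sum k d (\<lambda>_. 1 :: real) - 1"])
    fix k d assume "\<bar>k\<bar> < int N"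
    from path_sum_step[OF this, of "\<lambda>_. 1 :: real" 1 d] trans_prob_sum[of k d]
    show "path_sum k d (\<lambda>_. 1 :: real) - 1 =
        trans_prob k d True *\<^sub>R (path_sum (k + 1) True (\<lambda>_. 1) - 1) +
        trans_prob k d False *\<^sub>R (path_sum (k - 1) False (\<lambda>_. 1) - 1)"
      by (simp add: algebra_simps)
  qed (simp add: path_sum_boundary)
  then show ?thesis by simp
qed

text \<open>The bridge to the product in \<open>path_prob\<close>. The list \<open>d # ss\<close> is
  \<open>ss\<close> delayed by one step, so its entry \<open>j\<close> is the direction before step
  \<open>j\<close>.\<close>

lemma path_weight_eq_prod:
  "path_weight k d ss =
     (if (\<forall>j<length ss. \<bar>pos k ss j\<bar> < int N) \<and> \<bar>pos k ss (length ss)\<bar> = int N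
      then \<Prod>j<length ss. trans_prob (pos k ss j) ((d # ss) ! j) (ss ! j) else 0)"
proof (induction ss arbitrary: k d)
  case (Cons s ss)
  show ?case unfolding path_weight.simps Cons.IH
    by (auto simp add: All_less_Suc2 prod.lessThan_Suc_shift pos_Cons_Suc simp del: prod.lessThan_Suc)
qed simp

section \<open>Decomposition at the last visit to the origin\<close>

definition avoid_mass :: "int \<Rightarrow> bool \<Rightarrow> real" where
  "avoid_mass k d = path_sum k d (\<lambda>ss. if visits k ss then 0 else 1)"

text \<open>The step from 0 to 1 is seen by \<open>g\<close> but carries no probability: that factor
  depends on the previous direction, and it sums to 1 over the two reflected excursions.\<close>

definition excursion_sum :: "(bool list \<Rightarrow> complex) \<Rightarrow> complex" where
  "excursion_sum g = path_sum 1 True (\<lambda>ss. if visits 1 ss then 0 else g (True # ss))"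

text \<open>Paths that never see the origin are left out because their meander is the whole path and
  not an excursion from 0.\<close>

definition meander_sum :: "(bool list \<Rightarrow> complex) \<Rightarrow> int \<Rightarrow> bool \<Rightarrow> complex" where
  "meander_sum g k d = path_sum k d (\<lambda>ss. if visits k ss then g (meander k ss) else 0)"

lemma avoid_mass_nonneg: "0 \<le> avoid_mass k d"
proof -
  have "path_sum k d (\<lambda>_. 0 :: real) \<le> avoid_mass k d"
    unfolding avoid_mass_def by (rule path_sum_mono[of _ 0 _ 1]) auto
  then show ?thesis by simp
qed

lemma excursion_sum_1: "excursion_sum (\<lambda>_. 1) = of_real (avoid_mass 1 True)"
proof -
  have "of_real (avoid_mass 1 True) =
      path_sum 1 True (\<lambda>ss. complex_of_real (if visits 1 ss then 0 else 1))"
    unfolding avoid_mass_def by (rule path_sum_of_real[symmetric, of _ 1]) auto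
  also have "\<dots> = excursion_sum (\<lambda>_. 1)"
    unfolding excursion_sum_def by (rule path_sum_cong) auto
  finally show ?thesis ..
qed

lemma avoid_mass_flip: "avoid_mass (- k) (\<not> d) = avoid_mass k d"
  unfolding avoid_mass_def by (simp add: path_sum_flip visits_flip)

lemma avoid_mass_zero [simp]: "avoid_mass 0 d = 0"
proof -
  have "visits 0 ss" for ss by (cases ss) auto
  then show ?thesis by (simp add: avoid_mass_def)
qed

text \<open>A one-step Harnack inequality: the chosen step has probability at least \<rho>, the
  other branch is nonnegative, and a start away from 0 is not itself a visit.\<close>

lemma avoid_mass_ge:
  assumes k: "k \<noteq> 0" "\<bar>k\<bar> < int N"
  shows "\<rho> * avoid_mass (k + step_val s) s \<le> avoid_mass k d"
proof -
  have "avoid_mass k d = trans_prob k d True * avoid_mass (k + 1) True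
      + trans_prob k d False * avoid_mass (k - 1) False"
    unfolding avoid_mass_def using k
    by (subst path_sum_step[where B = 1]) auto
  moreover have "\<rho> * avoid_mass k' d' \<le> trans_prob k d s * avoid_mass k' d'" for k' d' s
    by (intro mult_right_mono trans_prob_ge avoid_mass_nonneg)
  from this[of "k + 1" True True] this[of "k - 1" False False]
  have "\<rho> * avoid_mass (k + 1) True \<le> trans_prob k d True * avoid_mass (k + 1) True"
    "\<rho> * avoid_mass (k - 1) False \<le> trans_prob k d False * avoid_mass (k - 1) False" .
  moreover have "0 \<le> \<rho> * avoid_mass k' d'" for k' d'
    using \<rho>_pos avoid_mass_nonneg by simp
  from this[of "k + 1" True] this[of "k - 1" False]
  have "0 \<le> \<rho> * avoid_mass (k + 1) True" "0 \<le> \<rho> * avoid_mass (k - 1) False" .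
  ultimately have "\<rho> * avoid_mass (k + 1) True \<le> avoid_mass k d"
    "\<rho> * avoid_mass (k - 1) False \<le> avoid_mass k d" by linarith+
  then show ?thesis by (cases s) simp_all
qed

lemma avoid_mass_le_up:
  assumes "Suc n \<le> N"
  shows "\<rho> ^ n * avoid_mass (int (Suc n)) True \<le> avoid_mass 1 True"
  using assms
proof (induction n)
  case (Suc n)
  have "\<rho> ^ n * (\<rho> * avoid_mass (int (Suc n) + 1) True) \<le> \<rho> ^ n * avoid_mass (int (Suc n)) True"
    using avoid_mass_ge[of "int (Suc n)" True True] Suc.prems \<rho>_pos
    by (intro mult_left_mono) auto
  also have "\<dots> \<le> avoid_mass 1 True" using Suc by simp
  finally show ?case by (simp add: mult_ac add.commute)
qed simp

lemma \<rho>_less_1: "\<rho> < 1"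
  using \<rho>_pos \<rho>_le[of 0] by linarith

text \<open>The upward state at \<open>n\<close> is reached from 1 by going straight up. For the
  downward state the walk goes up to \<open>n + 1\<close> and turns, which explains the exponent
  \<open>Suc n\<close> and the hypothesis \<open>Suc n < N\<close>.\<close>

lemma avoid_mass_le_nonneg:
  assumes "Suc n < N"
  shows "\<rho> ^ Suc n * avoid_mass (int n) d \<le> avoid_mass 1 True"
proof (cases "n = 0")
  case False
  then obtain n' where n: "n = Suc n'" by (cases n) auto
  show ?thesis
  proof (cases d)
    case True
    have "\<rho> ^ Suc n * avoid_mass (int n) d \<le> \<rho> ^ n' * avoid_mass (int n) d"
      using \<rho>_pos \<rho>_less_1 avoid_mass_nonneg n by (intro mult_right_mono power_decreasing) auto
    also have "\<dots> \<le> avoid_mass 1 True"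
      using avoid_mass_le_up[of n'] assms n True by simp
    finally show ?thesis .
  next
    case False
    have "\<rho> ^ n * (\<rho> * avoid_mass (int n) d) \<le> \<rho> ^ n * avoid_mass (int (Suc n)) True"
      using avoid_mass_ge[of "int (Suc n)" False True] assms False \<rho>_pos
      by (intro mult_left_mono) auto
    also have "\<dots> \<le> avoid_mass 1 True" using avoid_mass_le_up[of n] assms by simp
    finally show ?thesis by (simp add: mult_ac)
  qed
qed (simp add: avoid_mass_nonneg)

lemma avoid_mass_le:
  assumes "\<bar>k\<bar> + 1 < int N"
  shows "\<rho> ^ Suc (nat \<bar>k\<bar>) * avoid_mass k d \<le> avoid_mass 1 True"
proof (cases "0 \<le> k")
  case True
  then show ?thesis using avoid_mass_le_nonneg[of "nat k" d] assms by auto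
next
  case False
  then show ?thesis
    using avoid_mass_le_nonneg[of "nat (- k)" "\<not> d"] assms avoid_mass_flip[of k d] by auto
qed

text \<open>Away from the origin a last visit lies in the continuation, so the sum is harmonic. At
  the origin the walk may leave for good, in either direction; by reflection both excursions have
  the same sum, so the source term does not depend on \<open>d\<close>.\<close>

lemma meander_sum_step:
  assumes k: "\<bar>k\<bar> < int N" and g: "\<And>ss. norm (g ss) \<le> 1" "\<And>ss. g (map Not ss) = g ss"
  shows "meander_sum g k d = trans_prob k d True *\<^sub>R meander_sum g (k + 1) True +
    trans_prob k d False *\<^sub>R meander_sum g (k - 1) False + (if k = 0 then excursion_sum g else 0)"
proof -
  let ?e = "\<lambda>s. path_sum (step_val s) s (\<lambda>ss. if visits (step_val s) ss then 0 else g (s # ss))"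
  have e: "?e s = excursion_sum g" for s
  proof (cases s)
    case False
    have "?e False = path_sum (- 1) (\<not> True) (\<lambda>ss. if visits (- 1) ss then 0 else g (False # ss))"
      by simp
    also have "\<dots> = path_sum 1 True (\<lambda>ss. if visits 1 ss then 0 else g (map Not (True # ss)))"
      using visits_flip[of 1] by (subst path_sum_flip) (simp cong: if_cong)
    also have "\<dots> = excursion_sum g" unfolding g(2) excursion_sum_def ..
    finally show ?thesis using False by (simp cong: if_cong)
  qed (simp add: excursion_sum_def cong: if_cong)
  have s: "path_sum (k + step_val s) s (\<lambda>ss. if visits k (s # ss) then g (meander k (s # ss)) else 0)
      = meander_sum g (k + step_val s) s + (if k = 0 then excursion_sum g else 0)" for s
  proof (cases "k = 0")
    case True
    have "path_sum (step_val s) s (\<lambda>ss. g (meander 0 (s # ss))) =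
        path_sum (step_val s) s (\<lambda>ss. (if visits (step_val s) ss then g (meander (step_val s) ss) else 0)
          + (if visits (step_val s) ss then 0 else g (s # ss)))"
      by (rule path_sum_cong) (simp add: meander_Cons)
    also have "\<dots> = meander_sum g (step_val s) s + ?e s"
      unfolding meander_sum_def by (rule path_sum_add[of _ 1 _ 1]) (use g in auto)
    finally show ?thesis using True e by simp
  next
    case False
    then show ?thesis
      unfolding meander_sum_def by (auto simp: meander_Cons intro!: path_sum_cong)
  qed
  have "meander_sum g k d = trans_prob k d True *\<^sub>R (meander_sum g (k + 1) True + (if k = 0 then excursion_sum g else 0)) +
    trans_prob k d False *\<^sub>R (meander_sum g (k - 1) False + (if k = 0 then excursion_sum g else 0))"
    unfolding meander_sum_def[of g k] using s[of True] s[of False]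
    by (subst path_sum_step[OF k, where B = 1]) (use g in auto)
  also have "\<dots> = trans_prob k d True *\<^sub>R meander_sum g (k + 1) True +
    trans_prob k d False *\<^sub>R meander_sum g (k - 1) False +
    (trans_prob k d True + trans_prob k d False) *\<^sub>R (if k = 0 then excursion_sum g else 0)"
    unfolding scaleR_add_left scaleR_add_right by simp
  finally show ?thesis unfolding trans_prob_sum by simp
qed

text \<open>Both \<open>meander_sum g\<close> and the probability of visiting the origin are multiples of the
  expected number of visits to the origin.\<close>

lemma meander_sum_proportional:
  assumes "0 < N" and k: "\<bar>k\<bar> \<le> int N"
    and g: "\<And>ss. norm (g ss) \<le> 1" "\<And>ss. g (map Not ss) = g ss"
  shows "meander_sum g k d * excursion_sum (\<lambda>_. 1) = excursion_sum g * meander_sum (\<lambda>_. 1) k d"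
proof -
  \<comment> \<open>Both meander sums solve the same equation with a source at the origin only.
    Cross multiplication by the sources cancels them, and uniqueness gives 0.\<close>
  let ?v = "\<lambda>k d. meander_sum g k d * excursion_sum (\<lambda>_. 1) - excursion_sum g * meander_sum (\<lambda>_. 1) k d"
  have "?v k d = 0"
  proof (rule maximum_principle_norm[OF _ _ k, of ?v])
    fix k d assume "\<bar>k\<bar> = int N"
    then have "meander_sum h k d = 0" for h
      using \<open>0 < N\<close> by (auto simp: meander_sum_def path_sum_boundary)
    then show "?v k d = 0" by simp
  next
    fix k d assume k: "\<bar>k\<bar> < int N"
    show "?v k d = trans_prob k d True *\<^sub>R ?v (k + 1) True + trans_prob k d False *\<^sub>R ?v (k - 1) False"
      unfolding meander_sum_step[of k g, OF k g] meander_sum_step[OF k, of "\<lambda>_. 1", simplified]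
      by (simp add: algebra_simps)
  qed
  then show ?thesis by simp
qed

lemma meander_sum_1:
  assumes "\<bar>k\<bar> \<le> int N"
  shows "meander_sum (\<lambda>_. 1) k d = 1 - of_real (avoid_mass k d)"
proof -
  have "path_sum k d (\<lambda>_. 1 :: real) = path_sum k d (\<lambda>ss. (if visits k ss then 1 else 0) + (if visits k ss then 0 else 1))"
    by (rule path_sum_cong) auto
  also have "\<dots> = path_sum k d (\<lambda>ss. (if visits k ss then 1 else 0)) + avoid_mass k d"
    unfolding avoid_mass_def by (rule path_sum_add[of _ 1 _ 1]) auto
  finally have "path_sum k d (\<lambda>ss. (if visits k ss then 1 else 0)) = 1 - avoid_mass k d"
    using total_mass[OF assms, of d] by simp
  moreover have "complex_of_real (path_sum k d (\<lambda>ss. (if visits k ss then 1 else 0))) =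
      path_sum k d (\<lambda>ss. complex_of_real (if visits k ss then 1 else 0))"
    by (rule path_sum_of_real[symmetric, of _ 1]) auto
  moreover have "\<dots> = meander_sum (\<lambda>_. 1) k d"
    unfolding meander_sum_def by (rule path_sum_cong) auto
  ultimately show ?thesis by simp
qed

definition start_sum :: "int \<Rightarrow> (bool list \<Rightarrow> complex) \<Rightarrow> complex" where
  "start_sum m g = (\<Sum>s\<in>UNIV. path_sum (m + step_val s) s (\<lambda>ss. g (meander m (s # ss)))) / 2"

text \<open>Both excursion sums will turn out to have order 1 / N, whereas the error is a product of
  two such terms, so it is still negligible after division by the excursion sum of 1. The power of
  \<rho> pays for the comparison of a neighbour of \<open>m\<close>, at distance at most
  \<open>\<bar>m\<bar> + 1\<close> from 0, with the state at 1.\<close>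

lemma start_sum_approx:
  assumes m: "\<bar>m\<bar> + 2 < int N"
    and g: "\<And>ss. norm (g ss) \<le> 1" "\<And>ss. g (map Not ss) = g ss"
  shows "\<rho> ^ (nat \<bar>m\<bar> + 2) * norm (start_sum m g * excursion_sum (\<lambda>_. 1) - excursion_sum g)
    \<le> (avoid_mass 1 True + norm (excursion_sum g)) * avoid_mass 1 True"
proof -
  let ?r = "\<lambda>s. path_sum (m + step_val s) s (\<lambda>ss. if visits (m + step_val s) ss then 0 else g (s # ss))"
  let ?A = "\<lambda>s. avoid_mass (m + step_val s) s"
  let ?E1 = "excursion_sum (\<lambda>_. 1)" and ?E = "excursion_sum g"
  have inside: "\<bar>m + step_val s\<bar> + 1 < int N" for s using m by (cases s) auto
  have r: "norm (?r s) \<le> ?A s" for s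
    unfolding avoid_mass_def by (rule norm_path_sum_le[where B = 1]) (use g in auto)
  have split: "path_sum (m + step_val s) s (\<lambda>ss. g (meander m (s # ss))) =
      meander_sum g (m + step_val s) s + ?r s" for s
  proof -
    have "path_sum (m + step_val s) s (\<lambda>ss. g (meander m (s # ss))) =
        path_sum (m + step_val s) s (\<lambda>ss. (if visits (m + step_val s) ss then g (meander (m + step_val s) ss) else 0)
          + (if visits (m + step_val s) ss then 0 else g (s # ss)))"
      by (rule path_sum_cong) (simp add: meander_Cons)
    also have "\<dots> = meander_sum g (m + step_val s) s + ?r s"
      unfolding meander_sum_def by (rule path_sum_add[of _ 1 _ 1]) (use g in auto)
    finally show ?thesis .
  qed
  \<comment> \<open>The visiting part is exactly proportional to the excursion sum; only the
    avoiding part \<open>?r\<close> and the missing mass \<open>?A\<close> contribute to the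
    error.\<close>
  have proportional: "meander_sum g (m + step_val s) s * ?E1 = ?E * (1 - of_real (?A s))" for s
    using meander_sum_proportional[of "m + step_val s" g s] meander_sum_1[of "m + step_val s" s]
      inside[of s] g by simp
  have diff: "start_sum m g * ?E1 - ?E = (\<Sum>s\<in>UNIV. ?r s * ?E1 - ?E * of_real (?A s)) / 2"
  proof -
    have "(meander_sum g (m + step_val s) s + ?r s) * ?E1 - ?E = ?r s * ?E1 - ?E * of_real (?A s)" for s
      using proportional[of s] by (simp add: algebra_simps)
    then have "(\<Sum>s\<in>UNIV. ?r s * ?E1 - ?E * of_real (?A s)) =
        (\<Sum>s\<in>UNIV. (meander_sum g (m + step_val s) s + ?r s) * ?E1 - ?E)" by simp
    then show ?thesis unfolding start_sum_def split by (simp add: UNIV_bool field_simps)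
  qed
  have "norm (start_sum m g * ?E1 - ?E) \<le> (\<Sum>s\<in>UNIV. norm (?r s * ?E1 - ?E * of_real (?A s))) / 2"
    unfolding diff by (simp add: norm_divide sum_norm_le)
  also have "\<dots> \<le> (\<Sum>s\<in>UNIV. (avoid_mass 1 True + norm ?E) * ?A s) / 2"
  proof (intro divide_right_mono sum_mono)
    fix s
    have "norm (?r s * ?E1 - ?E * of_real (?A s)) \<le> norm (?r s) * norm ?E1 + norm ?E * ?A s"
      using avoid_mass_nonneg[of "m + step_val s" s]
        norm_triangle_ineq4[of "?r s * ?E1" "?E * of_real (?A s)"] by (simp add: norm_mult)
    also have "\<dots> \<le> ?A s * avoid_mass 1 True + norm ?E * ?A s"
      using r[of s] avoid_mass_nonneg[of 1 True]
      by (intro add_right_mono) (simp add: excursion_sum_1 mult_right_mono)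
    finally show "norm (?r s * ?E1 - ?E * of_real (?A s)) \<le> (avoid_mass 1 True + norm ?E) * ?A s"
      by (simp add: algebra_simps)
  qed simp
  finally have bound: "norm (start_sum m g * ?E1 - ?E) \<le> (\<Sum>s\<in>UNIV. (avoid_mass 1 True + norm ?E) * ?A s) / 2" .
  have A: "\<rho> ^ (nat \<bar>m\<bar> + 2) * ?A s \<le> avoid_mass 1 True" for s
  proof -
    have "\<rho> ^ (nat \<bar>m\<bar> + 2) * ?A s \<le> \<rho> ^ Suc (nat \<bar>m + step_val s\<bar>) * ?A s"
      using \<rho>_pos \<rho>_less_1 avoid_mass_nonneg
      by (intro mult_right_mono power_decreasing) (cases s; auto)+
    also have "\<dots> \<le> avoid_mass 1 True" by (rule avoid_mass_le[OF inside])
    finally show ?thesis .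
  qed
  have "\<rho> ^ (nat \<bar>m\<bar> + 2) * norm (start_sum m g * ?E1 - ?E) \<le>
      \<rho> ^ (nat \<bar>m\<bar> + 2) * ((\<Sum>s\<in>UNIV. (avoid_mass 1 True + norm ?E) * ?A s) / 2)"
    using bound \<rho>_pos by (intro mult_left_mono) auto
  also have "\<dots> = (\<Sum>s\<in>UNIV. (avoid_mass 1 True + norm ?E) * (\<rho> ^ (nat \<bar>m\<bar> + 2) * ?A s)) / 2"
    by (simp add: UNIV_bool algebra_simps)
  also have "\<dots> \<le> (\<Sum>s\<in>(UNIV :: bool set). (avoid_mass 1 True + norm ?E) * avoid_mass 1 True) / 2"
    using A avoid_mass_nonneg by (intro divide_right_mono sum_mono mult_left_mono) auto
  finally show ?thesis by (simp add: UNIV_bool)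
qed

end

section \<open>Path statistics\<close>

definition path_stat :: "complex \<Rightarrow> complex \<Rightarrow> complex \<Rightarrow> bool list \<Rightarrow> complex" where
  "path_stat s y z ss = s ^ length ss * y ^ num_runs ss * z ^ num_short_runs ss"

text \<open>The weight of the continuation \<open>ss\<close> of a path whose current run has direction \<open>d\<close> and, if
  \<open>short\<close>, consists of a single step so far. The factor \<open>z\<close> is charged when a short run ends.\<close>

primrec run_weight :: "complex \<Rightarrow> complex \<Rightarrow> complex \<Rightarrow> bool \<Rightarrow> bool \<Rightarrow> bool list \<Rightarrow> complex" where
  "run_weight s y z short d [] = (if short then z else 1)"
| "run_weight s y z short d (e # ss) = s * (if e = d then run_weight s y z False d ss
     else y * (if short then z else 1) * run_weight s y z True e ss)"

lemma runlens_Cons_neq: "runlens (d # ss) \<noteq> []"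
  by (auto split: list.splits)

lemma hd_runlens_pos: "0 < hd (runlens (d # ss))"
  by (auto split: list.splits)

text \<open>The run of length \<open>l\<close> contains the prefixed step \<open>d\<close>. The
  factors \<open>s\<close> and \<open>y\<close> of that step are paid elsewhere, so only the pending
  factor \<open>z\<close> of its run appears here.\<close>

lemma run_weight_runlens:
  assumes "runlens (d # ss) = l # ls"
  shows "run_weight s y z short d ss =
    s ^ length ss * y ^ length ls * z ^ length (filter (\<lambda>l. l = 1) ls) * (if short \<and> l = 1 then z else 1)"
  using assms
proof (induction ss arbitrary: short d l ls)
  case (Cons e ss)
  obtain l' ls' where r: "runlens (e # ss) = l' # ls'"
    using runlens_Cons_neq[of e ss] by (cases "runlens (e # ss)") auto
  have l': "l' \<noteq> 0" using hd_runlens_pos[of e ss] unfolding r by simp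
  have "runlens (d # e # ss) = (if d = e then Suc l' # ls' else 1 # l' # ls')"
    by (subst runlens.simps(2)) (simp add: r del: runlens.simps)
  note eq = this[unfolded Cons.prems]
  show ?case
  proof (cases "e = d")
    case True
    then have "l = Suc l'" "ls = ls'" using eq by auto
    then show ?thesis using Cons.IH[OF r, of False] True l' by simp
  next
    case False
    then have "l = 1" "ls = l' # ls'" using eq by auto
    then show ?thesis using Cons.IH[OF r, of True] False by simp
  qed
qed auto

lemma path_stat_Cons: "path_stat s y z (d # ss) = s * y * run_weight s y z True d ss"
proof -
  obtain l ls where r: "runlens (d # ss) = l # ls"
    using runlens_Cons_neq[of d ss] by (cases "runlens (d # ss)") auto
  show ?thesis
    unfolding path_stat_def num_runs_def num_short_runs_def run_weight_runlens[OF r] r by simp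
qed

lemma runlens_map_Not: "runlens (map Not ss) = runlens ss"
  by (induction ss) (auto split: list.splits)

lemma path_stat_map_Not: "path_stat s y z (map Not ss) = path_stat s y z ss"
  by (simp add: path_stat_def num_runs_def num_short_runs_def runlens_map_Not)

section \<open>Linear recursions for excursion sums\<close>

context persistent_walk
begin

definition avoid_sum :: "complex \<Rightarrow> complex \<Rightarrow> complex \<Rightarrow> bool \<Rightarrow> int \<Rightarrow> bool \<Rightarrow> complex" where
  "avoid_sum s y z short k d = path_sum k d (\<lambda>ss. if visits k ss then 0 else run_weight s y z short d ss)"

context
  fixes s y z :: complex
  assumes norms: "norm s = 1" "norm y = 1" "norm z = 1"
begin

lemma norm_run_weight: "norm (run_weight s y z short d ss) = 1"
  by (induction ss arbitrary: short d) (auto simp: norm_mult norms)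

lemma norm_path_stat: "norm (path_stat s y z ss) = 1"
  by (simp add: path_stat_def norm_mult norm_power norms)

lemma avoid_sum_0: "avoid_sum s y z short 0 d = 0"
proof -
  have "visits 0 ss" for ss by (cases ss) auto
  then show ?thesis by (simp add: avoid_sum_def)
qed

lemma avoid_sum_boundary: "0 < N \<Longrightarrow> avoid_sum s y z short (int N) d = (if short then z else 1)"
  by (simp add: avoid_sum_def path_sum_boundary)

lemma avoid_sum_step:
  assumes "k \<noteq> 0" "\<bar>k\<bar> < int N"
  shows "avoid_sum s y z short k d = s * of_real (\<alpha> k) * avoid_sum s y z False (k + step_val d) d +
    s * of_real (1 - \<alpha> k) * y * (if short then z else 1) * avoid_sum s y z True (k - step_val d) (\<not> d)"
proof -
  have step: "path_sum (k + step_val e) e (\<lambda>ss. if visits k (e # ss) then 0 else run_weight s y z short d (e # ss)) =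
      (if e = d then s * avoid_sum s y z False (k + step_val e) e
       else s * y * (if short then z else 1) * avoid_sum s y z True (k + step_val e) e)" for e
    unfolding avoid_sum_def path_sum_mult_left[symmetric] using assms(1) by (cases "e = d") (auto intro!: path_sum_cong)
  have "avoid_sum s y z short k d =
    trans_prob k d True *\<^sub>R path_sum (k + 1) True (\<lambda>ss. if visits k (True # ss) then 0 else run_weight s y z short d (True # ss)) +
    trans_prob k d False *\<^sub>R path_sum (k - 1) False (\<lambda>ss. if visits k (False # ss) then 0 else run_weight s y z short d (False # ss))"
    unfolding avoid_sum_def by (rule path_sum_step[OF assms(2), of _ 1]) (simp add: norm_run_weight del: run_weight.simps)
  with step[of True] step[of False] show ?thesis
    by (cases d) (simp_all add: trans_prob_def scaleR_conv_of_real del: run_weight.simps visits.simps)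
qed

lemma excursion_sum_path_stat: "excursion_sum (path_stat s y z) = s * y * avoid_sum s y z True 1 True"
  unfolding excursion_sum_def avoid_sum_def path_sum_mult_left[symmetric]
  by (rule path_sum_cong) (simp add: path_stat_Cons)

text \<open>A short and a long current run differ only in the factor paid at an immediate turn. This
  removes the long sums from the system.\<close>

lemma avoid_sum_long:
  assumes "k \<noteq> 0" "\<bar>k\<bar> < int N"
  shows "avoid_sum s y z False k d = avoid_sum s y z True k d -
    s * of_real (1 - \<alpha> k) * (y * (z - 1)) * avoid_sum s y z True (k - step_val d) (\<not> d)"
  unfolding avoid_sum_step[OF assms, of True d] avoid_sum_step[OF assms, of False d] by (simp add: algebra_simps)

text \<open>One step from site \<open>j + 1\<close>, then elimination of the long sum at
  \<open>j + 2\<close>. The elimination brings in the persistence of the second site and requires it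
  to be interior.\<close>

lemma avoid_sum_up:
  assumes "j + 2 < N"
  defines "\<beta> \<equiv> \<alpha> (int (Suc j))" and "\<beta>' \<equiv> \<alpha> (int (Suc (Suc j)))"
  shows "avoid_sum s y z True (int j + 1) True = s * of_real \<beta> * avoid_sum s y z True (int (Suc j) + 1) True
    - s * s * of_real \<beta> * of_real (1 - \<beta>') * (y * (z - 1)) * avoid_sum s y z True (int (Suc j)) False
    + s * of_real (1 - \<beta>) * y * z * avoid_sum s y z True (int j) False"
  unfolding \<beta>_def \<beta>'_def
  using avoid_sum_step[of "int j + 1" True True] avoid_sum_long[of "int j + 2" True] assms(1)
  by (simp add: algebra_simps)

lemma avoid_sum_down:
  assumes "0 < j" "j + 1 < N"
  defines "\<beta> \<equiv> \<alpha> (int (Suc j))" and "\<beta>' \<equiv> \<alpha> (int j)"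
  shows "avoid_sum s y z True (int (Suc j)) False = s * of_real \<beta> * avoid_sum s y z True (int j) False
    - s * s * of_real \<beta> * of_real (1 - \<beta>') * (y * (z - 1)) * avoid_sum s y z True (int j + 1) True
    + s * of_real (1 - \<beta>) * y * z * avoid_sum s y z True (int (Suc j) + 1) True"
  unfolding \<beta>_def \<beta>'_def
  using avoid_sum_step[of "int j + 1" True False] avoid_sum_long[of "int j" False] assms(1,2)
  by (simp add: algebra_simps)

lemma avoid_sum_down_1:
  assumes "2 < N"
  shows "avoid_sum s y z True 1 False = s * of_real (1 - \<alpha> 1) * y * z * avoid_sum s y z True 2 True"
  using avoid_sum_step[of 1 True False] avoid_sum_0 assms by simp

text \<open>A walk that keeps its direction into \<open>N\<close> ends with a long run, hence no
  factor \<open>z\<close> in the first term.\<close>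

lemma avoid_sum_last:
  assumes "2 < N"
  shows "avoid_sum s y z True (int N - 1) True = s * of_real (\<alpha> (int N - 1)) +
    s * of_real (1 - \<alpha> (int N - 1)) * y * z * avoid_sum s y z True (int N - 2) False"
  using avoid_sum_step[of "int N - 1" True True] avoid_sum_boundary[of False True] assms by simp

end

end

section \<open>Linear recursions close to a hyperbolic rotation\<close>

lemma discrete_gronwall:
  fixes e :: "nat \<Rightarrow> real"
  assumes step: "\<And>j. j < J \<Longrightarrow> e (Suc j) \<le> (1 + G) * e j + D"
    and G: "0 \<le> G" and D: "0 \<le> D" and e0: "0 \<le> e 0" and j: "j \<le> J"
  shows "e j \<le> exp (real j * G) * (e 0 + real j * D)"
  using j
proof (induction j)
  case (Suc j)
  have "e (Suc j) \<le> (1 + G) * (exp (real j * G) * (e 0 + real j * D)) + D"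
    using step[of j] Suc G by (smt (verit) Suc_le_lessD mult_left_mono less_imp_le_nat)
  also have "\<dots> \<le> exp G * (exp (real j * G) * (e 0 + real j * D)) + exp (real (Suc j) * G) * D"
    using G D e0 exp_ge_add_one_self[of G] by (intro add_mono mult_right_mono) (auto simp: mult_le_cancel_right1)
  also have "\<dots> = exp (real (Suc j) * G) * (e 0 + real (Suc j) * D)"
    by (simp add: algebra_simps exp_add)
  finally show ?case .
qed simp

lemma norm_linear_pair_le:
  fixes x y :: complex
  shows "norm (a11 * x + a12 * y) + norm (a21 * x + a22 * y) \<le>
    (norm a11 + norm a12 + norm a21 + norm a22) * (norm x + norm y)"
proof -
  have "norm (a11 * x + a12 * y) \<le> norm a11 * norm x + norm a12 * norm y"
    "norm (a21 * x + a22 * y) \<le> norm a21 * norm x + norm a22 * norm y"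
    by (simp_all add: norm_triangle_le norm_mult)
  moreover have "0 \<le> norm a11 * norm y" "0 \<le> norm a12 * norm x" "0 \<le> norm a21 * norm y" "0 \<le> norm a22 * norm x"
    by simp_all
  ultimately show ?thesis unfolding distrib_left distrib_right by linarith
qed

lemma norm_near_identity_le:
  fixes x y :: complex
  shows "norm (a11 * x + a12 * y) + norm (a21 * x + a22 * y) \<le>
    (1 + (norm (a11 - 1) + norm a12 + norm a21 + norm (a22 - 1))) * (norm x + norm y)"
proof -
  have "norm (a11 * x + a12 * y) + norm (a21 * x + a22 * y)
      \<le> norm x + norm y + (norm ((a11 - 1) * x + a12 * y) + norm (a21 * x + (a22 - 1) * y))"
    using norm_triangle_ineq[of x "(a11 - 1) * x + a12 * y"] norm_triangle_ineq[of y "a21 * x + (a22 - 1) * y"]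
    by (simp add: algebra_simps)
  with norm_linear_pair_le[of "a11 - 1" x a12 y a21 "a22 - 1"] show ?thesis
    by (simp add: algebra_simps)
qed

text \<open>The difference of the two solutions grows by 1 + G per step and receives D times the
  size of the comparison solution, which is itself controlled by H. For G and H of order 1 / J and D
  of smaller order the bound tends to 0.\<close>

lemma linear_recursion_perturbation:
  fixes u v u' v' :: "nat \<Rightarrow> complex"
  assumes uv: "\<And>j. j < J \<Longrightarrow> u (Suc j) = a11 * u j + a12 * v j"
      "\<And>j. j < J \<Longrightarrow> v (Suc j) = a21 * u j + a22 * v j"
    and uv': "\<And>j. j < J \<Longrightarrow> u' (Suc j) = b11 * u' j + b12 * v' j"
      "\<And>j. j < J \<Longrightarrow> v' (Suc j) = b21 * u' j + b22 * v' j"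
    and init: "u' 0 = u 0" "v' 0 = v 0"
  defines "G \<equiv> norm (a11 - 1) + norm a12 + norm a21 + norm (a22 - 1)"
    and "H \<equiv> norm (b11 - 1) + norm b12 + norm b21 + norm (b22 - 1)"
    and "D \<equiv> norm (a11 - b11) + norm (a12 - b12) + norm (a21 - b21) + norm (a22 - b22)"
  shows "norm (u J - u' J) + norm (v J - v' J) \<le>
    exp (real J * G) * (real J * (D * (exp (real J * H) * (norm (u 0) + norm (v 0)))))"
proof -
  have nonneg: "0 \<le> G" "0 \<le> H" "0 \<le> D" by (simp_all add: G_def H_def D_def)
  define K where "K = exp (real J * H) * (norm (u 0) + norm (v 0))"
  have K: "norm (u' j) + norm (v' j) \<le> K" if "j \<le> J" for j
  proof -
    have "norm (u' j) + norm (v' j) \<le> exp (real j * H) * ((norm (u' 0) + norm (v' 0)) + real j * 0)"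
      by (rule discrete_gronwall[of J])
         (use that nonneg norm_near_identity_le in \<open>auto simp: uv' H_def\<close>)
    also have "\<dots> \<le> K" unfolding K_def init
      using that nonneg by (auto intro!: mult_right_mono)
    finally show ?thesis .
  qed
  have "norm (u J - u' J) + norm (v J - v' J) \<le>
    exp (real J * G) * ((norm (u 0 - u' 0) + norm (v 0 - v' 0)) + real J * (D * K))"
  proof (rule discrete_gronwall[of J])
    fix j assume j: "j < J"
    let ?p = "u j - u' j" and ?q = "v j - v' j"
    have "norm (u (Suc j) - u' (Suc j)) + norm (v (Suc j) - v' (Suc j)) =
      norm ((a11 * ?p + a12 * ?q) + ((a11 - b11) * u' j + (a12 - b12) * v' j)) +
      norm ((a21 * ?p + a22 * ?q) + ((a21 - b21) * u' j + (a22 - b22) * v' j))"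
      using j by (simp add: uv uv' algebra_simps)
    also have "\<dots> \<le> (norm (a11 * ?p + a12 * ?q) + norm (a21 * ?p + a22 * ?q)) +
      (norm ((a11 - b11) * u' j + (a12 - b12) * v' j) + norm ((a21 - b21) * u' j + (a22 - b22) * v' j))"
      using norm_triangle_ineq add_mono by (smt (verit))
    also have "\<dots> \<le> (1 + G) * (norm ?p + norm ?q) + D * (norm (u' j) + norm (v' j))"
      unfolding G_def D_def by (intro add_mono norm_near_identity_le norm_linear_pair_le)
    also have "\<dots> \<le> (1 + G) * (norm ?p + norm ?q) + D * K"
      using K[of j] j nonneg by (intro add_left_mono mult_left_mono) auto
    finally show "norm (u (Suc j) - u' (Suc j)) + norm (v (Suc j) - v' (Suc j)) \<le>
      (1 + G) * (norm ?p + norm ?q) + D * K" .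
  qed (use nonneg in \<open>auto simp: K_def\<close>)
  then show ?thesis by (simp add: init K_def)
qed

text \<open>The value at \<omega> = 0 is the continuous extension, so t = 0 stays inside the general
  argument. If G has off-diagonal entries g, c with g c = \<omega>^2 and zero diagonal, then exp (x
  G) has diagonal cosh (\<omega> x) and off-diagonal entries g and c times this function.\<close>

definition sinhc :: "real \<Rightarrow> real \<Rightarrow> real" where
  "sinhc \<omega> x = (if \<omega> = 0 then x else sinh (\<omega> * x) / \<omega>)"

lemma sinhc_0 [simp]: "sinhc \<omega> 0 = 0"
  by (simp add: sinhc_def)

lemma sinhc_add: "sinhc \<omega> (x + y) = cosh (\<omega> * y) * sinhc \<omega> x + cosh (\<omega> * x) * sinhc \<omega> y"
  by (simp add: sinhc_def sinh_add distrib_left add_divide_distrib)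

lemma cosh_add_sinhc: "cosh (\<omega> * (x + y)) = cosh (\<omega> * x) * cosh (\<omega> * y) + \<omega>\<^sup>2 * sinhc \<omega> x * sinhc \<omega> y"
  by (simp add: sinhc_def cosh_add distrib_left power2_eq_square)

lemma continuous_sinhc: "continuous (at x) (sinhc \<omega>)"
proof (cases "\<omega> = 0")
  case True
  then have "sinhc \<omega> = (\<lambda>x. x)" by (auto simp: sinhc_def)
  then show ?thesis by simp
next
  case False
  then have "sinhc \<omega> = (\<lambda>x. sinh (\<omega> * x) / \<omega>)" by (auto simp: sinhc_def)
  then show ?thesis using False by (auto intro!: continuous_intros)
qed

lemma tendsto_sinhc: "(f \<longlongrightarrow> x) F \<Longrightarrow> ((\<lambda>n. sinhc \<omega> (f n)) \<longlongrightarrow> sinhc \<omega> x) F"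
  using continuous_within_tendsto_compose'[OF continuous_sinhc[of x \<omega>]] by auto

lemma cosh_scaled_limit: "(\<lambda>n. real n * (cosh (\<omega> * (1 / real n)) - 1)) \<longlonglongrightarrow> 0"
  unfolding cosh_field_def by real_asymp

lemma sinhc_scaled_limit: "(\<lambda>n. real n * sinhc \<omega> (1 / real n)) \<longlonglongrightarrow> 1"
proof (cases "\<omega> = 0")
  case True
  have "(\<lambda>n. real n * (1 / real n)) \<longlonglongrightarrow> 1" by real_asymp
  then show ?thesis using True by (simp add: sinhc_def)
next
  case False
  have "(\<lambda>n. real n * (sinh (\<omega> * (1 / real n)) / \<omega>)) \<longlonglongrightarrow> \<omega> / \<omega>"
    using False unfolding sinh_field_def by (cases "\<omega> > 0"; real_asymp)
  then show ?thesis using False by (simp add: sinhc_def)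
qed


text \<open>About \<tau> n steps with matrix I + G / n + o(1 / n) amount to exp (\<tau> G). The
  comparison recursion has the matrix exp (G / n) itself, whose powers are explicit by the addition
  formulas.\<close>

lemma hyperbolic_recursion_limit:
  fixes F :: "nat filter" and J :: "nat \<Rightarrow> nat" and u v :: "nat \<Rightarrow> nat \<Rightarrow> complex" and g c :: complex
  assumes F: "F \<le> sequentially"
    and J: "((\<lambda>n. real (J n) / real n) \<longlongrightarrow> \<tau>) F"
    and a: "((\<lambda>n. of_nat n * (a11 n - 1)) \<longlongrightarrow> 0) F" "((\<lambda>n. of_nat n * a12 n) \<longlongrightarrow> g) F"
      "((\<lambda>n. of_nat n * a21 n) \<longlongrightarrow> c) F" "((\<lambda>n. of_nat n * (a22 n - 1)) \<longlongrightarrow> 0) F"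
    and gc: "g * c = of_real (\<omega>\<^sup>2)"
    and uv: "\<forall>\<^sub>F n in F. \<forall>j<J n. u n (Suc j) = a11 n * u n j + a12 n * v n j"
      "\<forall>\<^sub>F n in F. \<forall>j<J n. v n (Suc j) = a21 n * u n j + a22 n * v n j"
    and init: "((\<lambda>n. u n 0) \<longlongrightarrow> u0) F" "((\<lambda>n. v n 0) \<longlongrightarrow> v0) F"
  shows "((\<lambda>n. u n (J n)) \<longlongrightarrow> of_real (cosh (\<omega> * \<tau>)) * u0 + g * of_real (sinhc \<omega> \<tau>) * v0) F" (is ?U)
    and "((\<lambda>n. v n (J n)) \<longlongrightarrow> c * of_real (sinhc \<omega> \<tau>) * u0 + of_real (cosh (\<omega> * \<tau>)) * v0) F" (is ?V)
proof -
  \<comment> \<open>The pair \<open>y1\<close>, \<open>y2\<close> is exp ((j / n) G) applied to the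
    same initial vector.\<close>
  define y1 where "y1 n j = of_real (cosh (\<omega> * (real j / real n))) * u n 0 + g * of_real (sinhc \<omega> (real j / real n)) * v n 0" for n j
  define y2 where "y2 n j = c * of_real (sinhc \<omega> (real j / real n)) * u n 0 + of_real (cosh (\<omega> * (real j / real n))) * v n 0" for n j
  define b11 where "b11 n = complex_of_real (cosh (\<omega> * (1 / real n)))" for n
  define b12 where "b12 n = g * of_real (sinhc \<omega> (1 / real n))" for n
  define b21 where "b21 n = c * of_real (sinhc \<omega> (1 / real n))" for n
  have y_Suc: "y1 n (Suc j) = b11 n * y1 n j + b12 n * y2 n j"
    "y2 n (Suc j) = b21 n * y1 n j + b11 n * y2 n j" for n j
  proof -
    have S: "real (Suc j) / real n = real j / real n + 1 / real n" by (simp add: add_divide_distrib)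
    show "y1 n (Suc j) = b11 n * y1 n j + b12 n * y2 n j" "y2 n (Suc j) = b21 n * y1 n j + b11 n * y2 n j"
      unfolding y1_def y2_def b11_def b12_def b21_def S cosh_add_sinhc sinhc_add of_real_add of_real_mult gc[symmetric]
      by (simp_all add: algebra_simps)
  qed
  have of_nat_scaled: "((\<lambda>n. of_nat n * complex_of_real (h n)) \<longlongrightarrow> of_real l) F"
    if "(\<lambda>n. real n * h n) \<longlonglongrightarrow> l" for h l
    using tendsto_of_real[OF tendsto_mono[OF F that], where 'a = complex] by simp
  have b: "((\<lambda>n. of_nat n * (b11 n - 1)) \<longlongrightarrow> 0) F"
    "((\<lambda>n. of_nat n * b12 n) \<longlongrightarrow> g) F" "((\<lambda>n. of_nat n * b21 n) \<longlongrightarrow> c) F"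
    using of_nat_scaled[OF cosh_scaled_limit[of \<omega>]]
      tendsto_mult[OF tendsto_const[of g] of_nat_scaled[OF sinhc_scaled_limit[of \<omega>]]]
      tendsto_mult[OF tendsto_const[of c] of_nat_scaled[OF sinhc_scaled_limit[of \<omega>]]]
    by (simp_all add: b11_def b12_def b21_def mult.left_commute)
  define G where "G n = norm (a11 n - 1) + norm (a12 n) + norm (a21 n) + norm (a22 n - 1)" for n
  define H where "H n = norm (b11 n - 1) + norm (b12 n) + norm (b21 n) + norm (b11 n - 1)" for n
  define D where "D n = norm (a11 n - b11 n) + norm (a12 n - b12 n) + norm (a21 n - b21 n) + norm (a22 n - b11 n)" for n
  have pos: "\<forall>\<^sub>F n in F. 0 < n" using filter_leD[OF F eventually_gt_at_top[of 0]] .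
  have J_mult: "((\<lambda>n. real (J n) * h n) \<longlongrightarrow> \<tau> * l) F" if "((\<lambda>n. real n * h n) \<longlongrightarrow> l) F" for h l
    using tendsto_mult[OF J that] pos
    by (rule Lim_transform_eventually[OF _ eventually_mono]) simp
  have norm_scaled: "real n * norm x = norm (of_nat n * x)" for n and x :: complex
    by (simp add: norm_mult)
  have "((\<lambda>n. real n * G n) \<longlongrightarrow> norm (0 :: complex) + norm g + norm c + norm (0 :: complex)) F"
    unfolding G_def distrib_left norm_scaled by (intro tendsto_intros a)
  note JG = tendsto_exp[OF J_mult[OF this]]
  have "((\<lambda>n. real n * H n) \<longlongrightarrow> norm (0 :: complex) + norm g + norm c + norm (0 :: complex)) F"
    unfolding H_def distrib_left norm_scaled by (intro tendsto_intros b)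
  note JH = tendsto_exp[OF J_mult[OF this]]
  have "((\<lambda>n. real n * D n) \<longlongrightarrow> 0) F"
  proof -
    have "((\<lambda>n. norm (of_nat n * (a11 n - 1) - of_nat n * (b11 n - 1)) + norm (of_nat n * a12 n - of_nat n * b12 n)
        + norm (of_nat n * a21 n - of_nat n * b21 n) + norm (of_nat n * (a22 n - 1) - of_nat n * (b11 n - 1)))
      \<longlongrightarrow> norm (0 - 0 :: complex) + norm (g - g) + norm (c - c) + norm (0 - 0 :: complex)) F"
      by (intro tendsto_intros a b)
    then show ?thesis
      unfolding D_def distrib_left norm_scaled by (simp flip: right_diff_distrib)
  qed
  note JD = J_mult[OF this]
  have "((\<lambda>n. exp (real (J n) * G n) * (real (J n) * D n) * (exp (real (J n) * H n) * (norm (u n 0) + norm (v n 0))))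
      \<longlongrightarrow> 0) F"
    using tendsto_mult[OF tendsto_mult[OF JG JD] tendsto_mult[OF JH tendsto_add[OF tendsto_norm[OF init(1)] tendsto_norm[OF init(2)]]]]
    by simp
  moreover have "\<forall>\<^sub>F n in F. norm (norm (u n (J n) - y1 n (J n)) + norm (v n (J n) - y2 n (J n))) \<le>
    exp (real (J n) * G n) * (real (J n) * D n) * (exp (real (J n) * H n) * (norm (u n 0) + norm (v n 0)))"
    using uv
  proof eventually_elim
    case (elim n)
    have "norm (u n (J n) - y1 n (J n)) + norm (v n (J n) - y2 n (J n)) \<le>
      exp (real (J n) * G n) * (real (J n) * (D n * (exp (real (J n) * H n) * (norm (u n 0) + norm (v n 0)))))"
      unfolding G_def D_def H_def
      by (rule linear_recursion_perturbation[of "J n" "u n" "a11 n" "a12 n" "v n" "a21 n" "a22 n" "y1 n" "b11 n" "b12 n" "y2 n" "b21 n" "b11 n"])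
         (use elim y_Suc in \<open>auto simp: y1_def y2_def\<close>)
    then show ?case by (simp add: mult_ac)
  qed
  ultimately have lim: "((\<lambda>n. norm (u n (J n) - y1 n (J n)) + norm (v n (J n) - y2 n (J n))) \<longlongrightarrow> 0) F"
    by (rule Lim_null_comparison[rotated])
  have diff: "((\<lambda>n. u n (J n) - y1 n (J n)) \<longlongrightarrow> 0) F" "((\<lambda>n. v n (J n) - y2 n (J n)) \<longlongrightarrow> 0) F"
    by (rule Lim_null_comparison[OF _ lim]; simp)+
  have ch: "((\<lambda>n. complex_of_real (cosh (\<omega> * (real (J n) / real n)))) \<longlongrightarrow> of_real (cosh (\<omega> * \<tau>))) F"
    by (intro tendsto_of_real tendsto_cosh tendsto_mult tendsto_const J)
  have sh: "((\<lambda>n. complex_of_real (sinhc \<omega> (real (J n) / real n))) \<longlongrightarrow> of_real (sinhc \<omega> \<tau>)) F"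
    by (intro tendsto_of_real tendsto_sinhc J)
  have "((\<lambda>n. y1 n (J n)) \<longlongrightarrow> of_real (cosh (\<omega> * \<tau>)) * u0 + g * of_real (sinhc \<omega> \<tau>) * v0) F"
    "((\<lambda>n. y2 n (J n)) \<longlongrightarrow> c * of_real (sinhc \<omega> \<tau>) * u0 + of_real (cosh (\<omega> * \<tau>)) * v0) F"
    unfolding y1_def y2_def by (intro tendsto_intros ch sh init)+
  from tendsto_add[OF diff(1) this(1)] tendsto_add[OF diff(2) this(2)] show ?U ?V by simp_all
qed

section \<open>The transfer matrix and its asymptotics\<close>

text \<open>The coefficient of \<open>U'\<close> once \<open>D'\<close> is eliminated in
  \<open>transfer_solve\<close>. Here \<sigma> is the weight of going on, \<open>A\<close> is 1
  minus the weight of a turn, and \<open>Bl\<close>, \<open>Br\<close> carry the influence of the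
  left and right neighbours.\<close>

definition transfer_det :: "complex \<Rightarrow> complex \<Rightarrow> complex \<Rightarrow> complex" where
  "transfer_det \<sigma> A Br = Br + A * (\<sigma> - Br)"

definition transfer11 :: "complex \<Rightarrow> complex \<Rightarrow> complex \<Rightarrow> complex \<Rightarrow> complex" where
  "transfer11 \<sigma> A Bl Br = (A + (\<sigma> - Br) * Bl) / transfer_det \<sigma> A Br"

definition transfer12 :: "complex \<Rightarrow> complex \<Rightarrow> complex \<Rightarrow> complex" where
  "transfer12 \<sigma> A Br = (1 - A - (\<sigma> - Br) * \<sigma>) / transfer_det \<sigma> A Br"

definition transfer21 :: "complex \<Rightarrow> complex \<Rightarrow> complex \<Rightarrow> complex \<Rightarrow> complex" where
  "transfer21 \<sigma> A Bl Br = (A\<^sup>2 - Bl * Br) / transfer_det \<sigma> A Br"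

definition transfer22 :: "complex \<Rightarrow> complex \<Rightarrow> complex \<Rightarrow> complex" where
  "transfer22 \<sigma> A Br = A * transfer12 \<sigma> A Br + \<sigma>"

text \<open>The coordinates are \<open>U\<close> and \<open>U - D\<close> because in the limit
  \<sigma>, \<open>A\<close>, \<open>Bl\<close>, \<open>Br\<close> all equal the persistence p, and
  then the matrix is unipotent upper triangular. Rescaling one coordinate can bring such a matrix
  close to the identity.\<close>

lemma transfer_solve:
  assumes "transfer_det \<sigma> A Br \<noteq> 0"
    and U: "U = \<sigma> * U' - (\<sigma> - Br) * D' + (1 - A) * D"
    and D: "D' = \<sigma> * D - (\<sigma> - Bl) * U + (1 - A) * U'"
  shows "U' = transfer11 \<sigma> A Bl Br * U + transfer12 \<sigma> A Br * (U - D)"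
    and "U' - D' = transfer21 \<sigma> A Bl Br * U + transfer22 \<sigma> A Br * (U - D)"
proof -
  let ?\<delta> = "transfer_det \<sigma> A Br"
  have "?\<delta> * U' = (A + (\<sigma> - Br) * Bl) * U + (1 - A - (\<sigma> - Br) * \<sigma>) * (U - D)"
    using U D unfolding transfer_det_def by algebra
  then show 1: "U' = transfer11 \<sigma> A Bl Br * U + transfer12 \<sigma> A Br * (U - D)"
    using assms(1) unfolding transfer11_def transfer12_def times_divide_eq_left add_divide_distrib[symmetric]
    by (simp add: eq_divide_eq mult.commute)
  have "A * transfer11 \<sigma> A Bl Br - Bl = transfer21 \<sigma> A Bl Br"
    using assms(1) unfolding transfer11_def transfer21_def
    by (simp add: divide_simps) (simp add: transfer_det_def algebra_simps power2_eq_square)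
  note 21 = this
  have "U' - D' = A * U' + \<sigma> * (U - D) - Bl * U" using D by algebra
  also have "\<dots> = (A * transfer11 \<sigma> A Bl Br - Bl) * U + transfer22 \<sigma> A Br * (U - D)"
    unfolding transfer22_def by (subst 1) (simp add: algebra_simps)
  finally show "U' - D' = transfer21 \<sigma> A Bl Br * U + transfer22 \<sigma> A Br * (U - D)"
    unfolding 21 .
qed

text \<open>Inside a stratum both neighbours give the same \<open>B\<close>, and the diagonal errors
  acquire the factor \<open>A - B\<close>, which is of second order by
  \<open>turn_link_second_order\<close>.\<close>

lemma transfer_diag:
  assumes "transfer_det \<sigma> A B \<noteq> 0"
  shows "transfer11 \<sigma> A B B - 1 = (A - B) * (1 - \<sigma> + B) / transfer_det \<sigma> A B"
    and "transfer22 \<sigma> A B - 1 = (A - B) * (1 - A - \<sigma>) / transfer_det \<sigma> A B"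
  using assms unfolding transfer11_def transfer22_def transfer12_def
  by (simp_all add: divide_simps) (simp_all add: transfer_det_def algebra_simps)

section \<open>Expansions of the phases\<close>

definition phase :: "real \<Rightarrow> nat \<Rightarrow> complex" where
  "phase x n = cis (x / real n)"

lemma norm_phase [simp]: "norm (phase x n) = 1"
  by (simp add: phase_def)

lemma phase_mult: "phase x n * phase y n = phase (x + y) n"
  by (simp add: phase_def cis_mult add_divide_distrib)

lemma phase_second_order:
  "(\<lambda>n. (of_nat n)\<^sup>2 * (phase x n - 1 - \<i> * of_real (x / real n))) \<longlonglongrightarrow> of_real (- x\<^sup>2 / 2)"
proof -
  have c: "(\<lambda>n. (real n)\<^sup>2 * (cos (x / real n) - 1)) \<longlonglongrightarrow> - x\<^sup>2 / 2"
    unfolding power2_eq_square[of x] minus_divide_left[symmetric] by real_asymp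
  have s: "(\<lambda>n. (real n)\<^sup>2 * (sin (x / real n) - x / real n)) \<longlonglongrightarrow> 0" by real_asymp
  have "(\<lambda>n. complex_of_real ((real n)\<^sup>2 * (cos (x / real n) - 1)) +
      \<i> * complex_of_real ((real n)\<^sup>2 * (sin (x / real n) - x / real n))) \<longlonglongrightarrow> of_real (- x\<^sup>2 / 2) + \<i> * of_real 0"
    by (intro tendsto_add tendsto_mult tendsto_const tendsto_of_real c s)
  moreover have "complex_of_real ((real n)\<^sup>2 * (cos (x / real n) - 1)) +
      \<i> * complex_of_real ((real n)\<^sup>2 * (sin (x / real n) - x / real n)) =
      (of_nat n)\<^sup>2 * (phase x n - 1 - \<i> * of_real (x / real n))" for n
    by (simp add: phase_def cis.ctr Complex_eq) (simp add: algebra_simps)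
  ultimately show ?thesis by (simp only: of_real_0 mult_zero_right add_0_right)
qed

lemma of_nat_inverse_tendsto_0: "(\<lambda>n. inverse (of_nat n :: complex)) \<longlonglongrightarrow> 0"
  by (rule lim_inverse_n)

lemma of_nat_scaled_from_square:
  fixes h :: "nat \<Rightarrow> complex"
  assumes "(\<lambda>n. (of_nat n)\<^sup>2 * h n) \<longlonglongrightarrow> l"
  shows "(\<lambda>n. of_nat n * h n) \<longlonglongrightarrow> 0"
proof -
  have "(\<lambda>n. inverse (of_nat n) * ((of_nat n)\<^sup>2 * h n)) \<longlonglongrightarrow> 0 * l"
    by (intro tendsto_mult of_nat_inverse_tendsto_0 assms)
  moreover have "\<forall>\<^sub>F n in sequentially. inverse (of_nat n) * ((of_nat n)\<^sup>2 * h n) = of_nat n * h n"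
    using eventually_gt_at_top[of 0] by eventually_elim (simp add: power2_eq_square)
  ultimately show ?thesis by (force intro: Lim_transform_eventually)
qed

lemma tendsto_0_from_scaled:
  fixes h :: "nat \<Rightarrow> complex"
  assumes "(\<lambda>n. of_nat n * h n) \<longlonglongrightarrow> l"
  shows "h \<longlonglongrightarrow> 0"
proof -
  have "(\<lambda>n. inverse (of_nat n) * (of_nat n * h n)) \<longlonglongrightarrow> 0 * l"
    by (intro tendsto_mult of_nat_inverse_tendsto_0 assms)
  moreover have "\<forall>\<^sub>F n in sequentially. inverse (of_nat n) * (of_nat n * h n) = h n"
    using eventually_gt_at_top[of 0] by eventually_elim simp
  ultimately show ?thesis by (force intro: Lim_transform_eventually)
qed

lemma phase_first_order: "(\<lambda>n. of_nat n * (phase x n - 1)) \<longlonglongrightarrow> \<i> * of_real x"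
proof -
  have "(\<lambda>n. of_nat n * (phase x n - 1 - \<i> * of_real (x / real n)) + \<i> * of_real x) \<longlonglongrightarrow> 0 + \<i> * of_real x"
    by (intro tendsto_add tendsto_const of_nat_scaled_from_square[OF phase_second_order])
  moreover have "\<forall>\<^sub>F n in sequentially. of_nat n * (phase x n - 1 - \<i> * of_real (x / real n)) + \<i> * of_real x = of_nat n * (phase x n - 1)"
    using eventually_gt_at_top[of 0] by eventually_elim (simp add: field_simps)
  ultimately show ?thesis by (force intro: Lim_transform_eventually)
qed

lemma phase_tendsto: "phase x \<longlonglongrightarrow> 1"
  using tendsto_0_from_scaled[OF phase_first_order[of x]] Lim_null by blast

text \<open>The persistence probability at the current site is \<open>p\<close>; the argument \<open>q\<close> of
  \<open>link\<close> is the reversal probability at a neighbouring site.\<close>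

locale phase_weights =
  fixes t c1 c2 :: real
begin

definition step_phase :: "nat \<Rightarrow> complex" where
  "step_phase n = phase t n"

definition run_phase :: "nat \<Rightarrow> complex" where
  "run_phase n = phase (- t * c1) n"

definition short_phase :: "nat \<Rightarrow> complex" where
  "short_phase n = phase (t * c2) n"

definition stay :: "real \<Rightarrow> nat \<Rightarrow> complex" where
  "stay p n = step_phase n * of_real p"

definition turn :: "real \<Rightarrow> nat \<Rightarrow> complex" where
  "turn p n = 1 - step_phase n * of_real (1 - p) * run_phase n * short_phase n"

definition link :: "real \<Rightarrow> real \<Rightarrow> nat \<Rightarrow> complex" where
  "link p q n = stay p n - step_phase n * stay p n * of_real q * (run_phase n * (short_phase n - 1))"

lemma step_phase_tendsto: "step_phase \<longlonglongrightarrow> 1"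
  and run_phase_tendsto: "run_phase \<longlonglongrightarrow> 1"
  and short_phase_tendsto: "short_phase \<longlonglongrightarrow> 1"
  using phase_tendsto by (simp_all add: step_phase_def[abs_def] run_phase_def[abs_def] short_phase_def[abs_def])

lemmas phases_tendsto = step_phase_tendsto run_phase_tendsto short_phase_tendsto

lemma stay_tendsto: "stay p \<longlonglongrightarrow> of_real p"
  unfolding stay_def[abs_def] by (rule tendsto_eq_intros phases_tendsto refl)+ simp

lemma turn_tendsto: "turn p \<longlonglongrightarrow> of_real p"
  unfolding turn_def[abs_def] by (rule tendsto_eq_intros phases_tendsto refl)+ simp

lemma link_tendsto: "link p q \<longlonglongrightarrow> of_real p"
  unfolding link_def[abs_def] by (rule tendsto_eq_intros phases_tendsto stay_tendsto refl)+ simp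

lemma transfer_det_tendsto: "(\<lambda>n. transfer_det (stay p n) (turn p n) (link p q n)) \<longlonglongrightarrow> of_real p"
  unfolding transfer_det_def by (rule tendsto_eq_intros stay_tendsto turn_tendsto link_tendsto refl)+ simp

text \<open>Here \<open>1 - p\<close> and \<open>r\<close> are the reversal probabilities of the
  current and the other stratum; \<open>c1\<close> and \<open>c2\<close> are symmetric in them, so
  one lemma serves both strata. For p = a and r = 1 - b the bracket in the numerator equals a + b^2
  - 2 a b.\<close>

lemma turn_link_second_order:
  assumes p: "p < 1" and r: "r \<noteq> 0" and c: "c1 = 1 / (1 - p) + 1 / r" "c2 = 1 / ((1 - p) * r)"
  shows "(\<lambda>n. (of_nat n)\<^sup>2 * (turn p n - link p (1 - p) n)) \<longlonglongrightarrow>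
    of_real (t\<^sup>2 * p * (1 - p + r\<^sup>2 - 2 * (1 - p) * r) / (2 * (1 - p) * r\<^sup>2))"
proof -
  define q where "q = 1 - p"
  have q: "q \<noteq> 0" "p = 1 - q" using p by (auto simp: q_def)
  define x1 x3 x4 where "x1 = t * (1 - c1 + c2)" and "x3 = t * (2 - c1 + c2)" and "x4 = t * (2 - c1)"
  define e where "e x n = phase x n - 1 - \<i> * of_real (x / real n)" for x n
  \<comment> \<open>Up to the factor \<open>t\<close> this is 1 - c1 q + c2 q^2, and q is a root by
    the choice of \<open>c1\<close> and \<open>c2\<close>.\<close>
  have linear: "q * x1 + p * t - p * q * x3 + p * q * x4 = 0"
    unfolding x1_def x3_def x4_def c q(2) using q(1) r by (simp add: field_simps)
  have eq: "turn p n - link p (1 - p) n =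
    - (of_real q * e x1 n) - of_real p * e t n + of_real (p * q) * e x3 n - of_real (p * q) * e x4 n" for n
  proof -
    have "step_phase n * run_phase n * short_phase n = phase x1 n"
      "step_phase n * step_phase n * run_phase n * short_phase n = phase x3 n"
      "step_phase n * step_phase n * run_phase n = phase x4 n"
      by (simp_all add: step_phase_def run_phase_def short_phase_def phase_mult x1_def x3_def x4_def algebra_simps)
    then have "turn p n - link p (1 - p) n = 1 - of_real q * phase x1 n - of_real p * phase t n
        + of_real (p * q) * phase x3 n - of_real (p * q) * phase x4 n"
      unfolding turn_def link_def stay_def of_real_mult q_def[symmetric] step_phase_def[symmetric]
      by (simp flip: \<open>_ = phase x1 n\<close> \<open>_ = phase x3 n\<close> \<open>_ = phase x4 n\<close> add: algebra_simps)
    also have "\<dots> = - (of_real q * e x1 n) - of_real p * e t n + of_real (p * q) * e x3 n - of_real (p * q) * e x4 n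
        - \<i> * of_real ((q * x1 + p * t - p * q * x3 + p * q * x4) / real n)"
      unfolding e_def q(2) by (simp add: algebra_simps add_divide_distrib diff_divide_distrib)
    finally show ?thesis by (simp add: linear)
  qed
  have e: "(\<lambda>n. (of_nat n)\<^sup>2 * e x n) \<longlonglongrightarrow> of_real (- x\<^sup>2 / 2)" for x
    unfolding e_def by (rule phase_second_order)
  have "(\<lambda>n. - (of_real q * ((of_nat n)\<^sup>2 * e x1 n)) - of_real p * ((of_nat n)\<^sup>2 * e t n)
      + of_real (p * q) * ((of_nat n)\<^sup>2 * e x3 n) - of_real (p * q) * ((of_nat n)\<^sup>2 * e x4 n)) \<longlonglongrightarrow>
    - (of_real q * of_real (- x1\<^sup>2 / 2)) - of_real p * of_real (- t\<^sup>2 / 2)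
      + of_real (p * q) * of_real (- x3\<^sup>2 / 2) - of_real (p * q) * of_real (- x4\<^sup>2 / 2)"
    by (intro tendsto_intros e)
  moreover have "- (q * (- x1\<^sup>2 / 2)) - p * (- t\<^sup>2 / 2) + p * q * (- x3\<^sup>2 / 2) - p * q * (- x4\<^sup>2 / 2)
    = t\<^sup>2 * p * (1 - p + r\<^sup>2 - 2 * (1 - p) * r) / (2 * (1 - p) * r\<^sup>2)"
    unfolding x1_def x3_def x4_def c q(2) using q(1) r
    by (simp add: field_simps power2_eq_square)
  note this[THEN arg_cong, of complex_of_real]
  ultimately show ?thesis unfolding eq by (simp add: algebra_simps)
qed


text \<open>Replacing the reversal probability \<open>1 - p\<close> of the neighbour by
  \<open>q\<close> changes \<open>link\<close> by a multiple of \<open>short_phase n - 1\<close>, of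
  order 1 / n. At the interface nothing cancels this term.\<close>

lemma turn_link_first_order:
  assumes p: "p < 1" and r: "r \<noteq> 0" and c: "c1 = 1 / (1 - p) + 1 / r" "c2 = 1 / ((1 - p) * r)"
  shows "(\<lambda>n. of_nat n * (turn p n - link p q n)) \<longlonglongrightarrow> \<i> * of_real (p * (q - (1 - p)) * (t * c2))"
proof -
  have "(\<lambda>n. of_nat n * (turn p n - link p (1 - p) n) +
      step_phase n * stay p n * of_real (q - (1 - p)) * run_phase n * (of_nat n * (short_phase n - 1)))
    \<longlonglongrightarrow> 0 + 1 * of_real p * of_real (q - (1 - p)) * 1 * (\<i> * of_real (t * c2))"
    by (intro tendsto_intros of_nat_scaled_from_square[OF turn_link_second_order[OF p r c]]
         phases_tendsto stay_tendsto phase_first_order[of "t * c2", folded short_phase_def])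
  then show ?thesis unfolding link_def by (simp add: algebra_simps)
qed

context
  fixes p :: real
  assumes p: "0 < p"
begin

lemma transfer_det_nonzero: "\<forall>\<^sub>F n in sequentially. transfer_det (stay p n) (turn p n) (link p q n) \<noteq> 0"
  using p by (intro tendsto_imp_eventually_ne[OF transfer_det_tendsto]) auto

lemma transfer11_tendsto:
  "(\<lambda>n. transfer11 (stay p n) (turn p n) (link p q n) (link p q' n)) \<longlonglongrightarrow> 1"
proof -
  have "(\<lambda>n. transfer11 (stay p n) (turn p n) (link p q n) (link p q' n)) \<longlonglongrightarrow>
    (of_real p + (of_real p - of_real p) * of_real p) / of_real p"
    unfolding transfer11_def
    by (intro tendsto_intros stay_tendsto turn_tendsto link_tendsto transfer_det_tendsto) (use p in auto)
  then show ?thesis using p by simp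
qed

lemma transfer12_tendsto:
  "(\<lambda>n. transfer12 (stay p n) (turn p n) (link p q n)) \<longlonglongrightarrow> of_real ((1 - p) / p)"
proof -
  have "(\<lambda>n. transfer12 (stay p n) (turn p n) (link p q n)) \<longlonglongrightarrow>
    (1 - of_real p - (of_real p - of_real p) * of_real p) / of_real p"
    unfolding transfer12_def
    by (intro tendsto_intros stay_tendsto turn_tendsto link_tendsto transfer_det_tendsto) (use p in auto)
  then show ?thesis using p by simp
qed

lemma transfer22_tendsto:
  "(\<lambda>n. transfer22 (stay p n) (turn p n) (link p q n)) \<longlonglongrightarrow> 1"
proof -
  have "(\<lambda>n. transfer22 (stay p n) (turn p n) (link p q n)) \<longlonglongrightarrow> of_real p * of_real ((1 - p) / p) + of_real p"
    unfolding transfer22_def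
    by (intro tendsto_intros stay_tendsto turn_tendsto transfer12_tendsto)
  then show ?thesis using p by (simp flip: of_real_add of_real_mult)
qed

context
  fixes r :: real
  assumes p1: "p < 1" and r: "r \<noteq> 0" and c: "c1 = 1 / (1 - p) + 1 / r" "c2 = 1 / ((1 - p) * r)"
begin

text \<open>\<open>A\<^sup>2 - Bl * Br = A * (A - Bl) + Bl * (A - Br)\<close>, so the first-order
  errors caused by the two neighbours add up.\<close>

lemma transfer21_first_order:
  "(\<lambda>n. of_nat n * transfer21 (stay p n) (turn p n) (link p q n) (link p q' n)) \<longlonglongrightarrow>
    \<i> * of_real (p * (q + q' - 2 * (1 - p)) * (t * c2))"
proof -
  have "(\<lambda>n. (turn p n * (of_nat n * (turn p n - link p q n)) + link p q n * (of_nat n * (turn p n - link p q' n)))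
      / transfer_det (stay p n) (turn p n) (link p q' n)) \<longlonglongrightarrow>
    (of_real p * (\<i> * of_real (p * (q - (1 - p)) * (t * c2))) + of_real p * (\<i> * of_real (p * (q' - (1 - p)) * (t * c2)))) / of_real p"
    by (intro tendsto_intros turn_link_first_order[OF p1 r c] turn_tendsto link_tendsto transfer_det_tendsto) (use p in auto)
  also have "(\<lambda>n. (turn p n * (of_nat n * (turn p n - link p q n)) + link p q n * (of_nat n * (turn p n - link p q' n)))
      / transfer_det (stay p n) (turn p n) (link p q' n)) =
    (\<lambda>n. of_nat n * transfer21 (stay p n) (turn p n) (link p q n) (link p q' n))"
    unfolding transfer21_def by (simp add: fun_eq_iff algebra_simps power2_eq_square)
  also have "(of_real p * (\<i> * of_real (p * (q - (1 - p)) * (t * c2))) + of_real p * (\<i> * of_real (p * (q' - (1 - p)) * (t * c2)))) / of_real p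
      = \<i> * of_real (p * (q + q' - 2 * (1 - p)) * (t * c2))"
    using p by (simp add: divide_eq_eq) (simp add: algebra_simps)
  finally show ?thesis .
qed

lemma transfer21_second_order:
  "(\<lambda>n. of_nat n * (of_nat n * transfer21 (stay p n) (turn p n) (link p (1 - p) n) (link p (1 - p) n))) \<longlonglongrightarrow>
    of_real (t\<^sup>2 * p * (1 - p + r\<^sup>2 - 2 * (1 - p) * r) / ((1 - p) * r\<^sup>2))"
proof -
  let ?l = "t\<^sup>2 * p * (1 - p + r\<^sup>2 - 2 * (1 - p) * r) / (2 * (1 - p) * r\<^sup>2)"
  have "(\<lambda>n. (of_nat n)\<^sup>2 * (turn p n - link p (1 - p) n) * (turn p n + link p (1 - p) n)
      / transfer_det (stay p n) (turn p n) (link p (1 - p) n)) \<longlonglongrightarrow>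
    of_real ?l * (of_real p + of_real p) / of_real p"
    by (intro tendsto_intros turn_link_second_order[OF p1 r c] turn_tendsto link_tendsto transfer_det_tendsto) (use p in auto)
  also have "(\<lambda>n. (of_nat n)\<^sup>2 * (turn p n - link p (1 - p) n) * (turn p n + link p (1 - p) n)
      / transfer_det (stay p n) (turn p n) (link p (1 - p) n)) =
    (\<lambda>n. of_nat n * (of_nat n * transfer21 (stay p n) (turn p n) (link p (1 - p) n) (link p (1 - p) n)))"
    unfolding transfer21_def by (simp add: fun_eq_iff algebra_simps power2_eq_square)
  also have "complex_of_real ?l * (of_real p + of_real p) / of_real p = of_real (2 * ?l)"
    using p by simp
  also have "2 * (x / (2 * y * z)) = x / (y * z)" for x y z :: real by simp
  finally show ?thesis .
qed

lemma transfer11_diag_first_order: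
  "(\<lambda>n. of_nat n * (transfer11 (stay p n) (turn p n) (link p (1 - p) n) (link p (1 - p) n) - 1)) \<longlonglongrightarrow> 0"
proof -
  have "(\<lambda>n. of_nat n * (turn p n - link p (1 - p) n) * (1 - stay p n + link p (1 - p) n)
      / transfer_det (stay p n) (turn p n) (link p (1 - p) n)) \<longlonglongrightarrow> 0 * (1 - of_real p + of_real p) / of_real p"
    by (intro tendsto_intros of_nat_scaled_from_square[OF turn_link_second_order[OF p1 r c]] stay_tendsto link_tendsto transfer_det_tendsto)
       (use p in auto)
  then show ?thesis
    by (rule Lim_transform_eventually[THEN tendsto_eq_rhs])
       (use transfer_det_nonzero[of "1 - p"] in \<open>auto elim: eventually_mono simp: transfer_diag\<close>)
qed

lemma transfer22_diag_first_order:
  "(\<lambda>n. of_nat n * (transfer22 (stay p n) (turn p n) (link p (1 - p) n) - 1)) \<longlonglongrightarrow> 0"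
proof -
  have "(\<lambda>n. of_nat n * (turn p n - link p (1 - p) n) * (1 - turn p n - stay p n)
      / transfer_det (stay p n) (turn p n) (link p (1 - p) n)) \<longlonglongrightarrow> 0 * (1 - of_real p - of_real p) / of_real p"
    by (intro tendsto_intros of_nat_scaled_from_square[OF turn_link_second_order[OF p1 r c]] stay_tendsto turn_tendsto transfer_det_tendsto)
       (use p in auto)
  then show ?thesis
    by (rule Lim_transform_eventually[THEN tendsto_eq_rhs])
       (use transfer_det_nonzero[of "1 - p"] in \<open>auto elim: eventually_mono simp: transfer_diag\<close>)
qed

end

end

end

section \<open>Shooting through the two strata\<close>

context phase_weights
begin

text \<open>\<open>U n 0\<close> is found by shooting: \<open>(U n j, U n j - D n (j + 1))\<close> is carried by transfer matrices from
  \<open>j = 1\<close> to \<open>j = n - 2\<close>, and the terminal condition then fixes its scale. Each stratum contributes a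
  hyperbolic rotation, and the two sites at the interface together add a multiple of the first
  component to the second one.\<close>

lemma two_strata_limit:
  fixes a b \<eta> \<omega>a \<omega>b :: real and f :: "nat \<Rightarrow> nat" and U D :: "nat \<Rightarrow> nat \<Rightarrow> complex"
  defines "p \<equiv> \<lambda>n. persist a b (f n)"
  assumes ab: "0 < a" "a < 1" "0 < b" "b < 1"
    and c: "c1 = 1 / (1 - a) + 1 / (1 - b)" "c2 = 1 / ((1 - a) * (1 - b))"
    and \<eta>: "0 < \<eta>" "\<eta> < 1" and f: "(\<lambda>n. real (f n) / real n) \<longlonglongrightarrow> \<eta>"
    and \<omega>a: "\<omega>a\<^sup>2 = t\<^sup>2 * (1 - a + (1 - b)\<^sup>2 - 2 * (1 - a) * (1 - b)) / (1 - b)\<^sup>2"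
    and \<omega>b: "\<omega>b\<^sup>2 = t\<^sup>2 * (1 - b + (1 - a)\<^sup>2 - 2 * (1 - b) * (1 - a)) / (1 - a)\<^sup>2"
    and U: "\<And>n j. j + 2 < n \<Longrightarrow> U n j = stay (p n (Suc j)) n * U n (Suc j)
      - (stay (p n (Suc j)) n - link (p n (Suc j)) (1 - p n (Suc (Suc j))) n) * D n (Suc (Suc j))
      + (1 - turn (p n (Suc j)) n) * D n (Suc j)"
    and D: "\<And>n j. 0 < j \<Longrightarrow> j + 1 < n \<Longrightarrow> D n (Suc (Suc j)) = stay (p n (Suc j)) n * D n (Suc j)
      - (stay (p n (Suc j)) n - link (p n (Suc j)) (1 - p n j) n) * U n j
      + (1 - turn (p n (Suc j)) n) * U n (Suc j)"
    and D12: "\<And>n. 2 < n \<Longrightarrow> D n 1 = 0" "\<And>n. 2 < n \<Longrightarrow> D n 2 = (1 - turn (p n 1) n) * U n 1"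
    and final: "\<And>n. 2 < n \<Longrightarrow> U n (n - 2) - (1 - turn (p n (n - 1)) n) * D n (n - 1) = (step_phase n)\<^sup>2 * of_real (p n (n - 1))"
  defines "ga \<equiv> (1 - a) / a" and "gb \<equiv> (1 - b) / b"
  defines "L \<equiv> complex_of_real (cosh (\<omega>b * (1 - \<eta>)) * (ga * sinhc \<omega>a \<eta>) + gb * sinhc \<omega>b (1 - \<eta>) * cosh (\<omega>a * \<eta>))
      + \<i> * of_real (gb * sinhc \<omega>b (1 - \<eta>) * (t * c2 * (a - b)\<^sup>2 * (ga * sinhc \<omega>a \<eta>)))"
  assumes L: "L \<noteq> 0"
  shows "(\<lambda>n. of_nat n * U n 0) \<longlonglongrightarrow> 1 / L"
proof -
  define X where "X n j = U n j - D n (Suc j)" for n j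
  have cb: "c1 = 1 / (1 - b) + 1 / (1 - a)" "c2 = 1 / ((1 - b) * (1 - a))"
    using c by (simp_all add: mult.commute)
  have a0: "1 - a \<noteq> 0" and b0: "1 - b \<noteq> 0" using ab by auto
  have f_ge: "\<forall>\<^sub>F n in sequentially. K \<le> f n" and f_le: "\<forall>\<^sub>F n in sequentially. f n + K \<le> n" for K
  proof -
    have n: "\<forall>\<^sub>F n in sequentially. 0 < n" by (rule eventually_gt_at_top)
    have "\<forall>\<^sub>F n in sequentially. \<eta> / 2 < real (f n) / real n"
      using order_tendstoD(1)[OF f, of "\<eta> / 2"] \<eta> by simp
    moreover have "\<forall>\<^sub>F n in sequentially. real K \<le> \<eta> / 2 * real n"
      using \<eta> by real_asymp
    ultimately show "\<forall>\<^sub>F n in sequentially. K \<le> f n" using n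
      by eventually_elim (simp add: field_simps)
    have "\<forall>\<^sub>F n in sequentially. real (f n) / real n < (1 + \<eta>) / 2"
      using order_tendstoD(2)[OF f, of "(1 + \<eta>) / 2"] \<eta> by simp
    moreover have "\<forall>\<^sub>F n in sequentially. (1 + \<eta>) / 2 * real n + real K \<le> real n"
      using \<eta> by real_asymp
    ultimately show "\<forall>\<^sub>F n in sequentially. f n + K \<le> n" using n
      by eventually_elim (simp add: field_simps)
  qed
  have large: "\<forall>\<^sub>F n in sequentially. 4 \<le> f n \<and> f n + 4 \<le> n"
    by (intro eventually_conj f_ge f_le)
  let ?det = "\<lambda>p q n. transfer_det (stay p n) (turn p n) (link p q n)"
  have det: "\<forall>\<^sub>F n in sequentially. ?det a (1 - a) n \<noteq> 0 \<and> ?det a (1 - b) n \<noteq> 0 \<and> ?det b (1 - b) n \<noteq> 0"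
    using ab by (intro eventually_conj transfer_det_nonzero) auto
  have det_p: "?det (p n k) (1 - p n (Suc k)) n \<noteq> 0"
    if "?det a (1 - a) n \<noteq> 0 \<and> ?det a (1 - b) n \<noteq> 0 \<and> ?det b (1 - b) n \<noteq> 0" for n k
    using that by (auto simp: p_def persist_def)
  have step: "U n (Suc j) = transfer11 (stay (p n (Suc j)) n) (turn (p n (Suc j)) n) (link (p n (Suc j)) (1 - p n j) n)
        (link (p n (Suc j)) (1 - p n (Suc (Suc j))) n) * U n j
      + transfer12 (stay (p n (Suc j)) n) (turn (p n (Suc j)) n) (link (p n (Suc j)) (1 - p n (Suc (Suc j))) n) * X n j"
    "X n (Suc j) = transfer21 (stay (p n (Suc j)) n) (turn (p n (Suc j)) n) (link (p n (Suc j)) (1 - p n j) n)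
        (link (p n (Suc j)) (1 - p n (Suc (Suc j))) n) * U n j
      + transfer22 (stay (p n (Suc j)) n) (turn (p n (Suc j)) n) (link (p n (Suc j)) (1 - p n (Suc (Suc j))) n) * X n j"
    if "0 < j" "j + 2 < n" "?det (p n (Suc j)) (1 - p n (Suc (Suc j))) n \<noteq> 0" for n j
    unfolding X_def using transfer_solve[OF that(3) U D] that by auto
  \<comment> \<open>The zero boundary value at the origin leaves one free parameter, so the vector
    at j = 1 is known up to scale.\<close>
  have first: "U n 0 = ?det a (1 - a) n * U n 1" "X n 1 = turn a n * U n 1" if "4 \<le> f n \<and> f n + 4 \<le> n" for n
  proof -
    have p: "p n (Suc 0) = a" "p n (Suc (Suc 0)) = a" using that by (auto simp: p_def persist_def)
    have D2: "D n (Suc (Suc 0)) = (1 - turn a n) * U n (Suc 0)"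
      using D12(2)[of n] that p by (simp add: numeral_2_eq_2)
    show "X n 1 = turn a n * U n 1" unfolding X_def using D2 by (simp add: algebra_simps)
    show "U n 0 = ?det a (1 - a) n * U n 1"
      using U[of 0 n] D12(1)[of n] that D2 unfolding p transfer_det_def by (simp add: algebra_simps)
  qed
  have last: "turn b n * U n (n - 2) + (1 - turn b n) * X n (n - 2) = (step_phase n)\<^sup>2 * of_real b"
    if "4 \<le> f n \<and> f n + 4 \<le> n" for n
  proof -
    have "p n (n - 1) = b" "Suc (n - 2) = n - 1" using that by (auto simp: p_def persist_def)
    then show ?thesis using final[of n] that by (simp add: X_def algebra_simps)
  qed
  \<comment> \<open>If \<open>U n 0\<close> were 0, the recursion would carry 0 up to the terminal
    condition, whose right side is not 0. Hence it can serve as the normalization.\<close>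
  have U0: "\<forall>\<^sub>F n in sequentially. U n 0 \<noteq> 0"
    using large det
  proof eventually_elim
    case (elim n)
    show ?case
    proof
      assume "U n 0 = 0"
      have "U n (Suc j) = 0 \<and> X n (Suc j) = 0" if "j + 3 \<le> n" for j
        using that
      proof (induction j)
        case 0
        then show ?case using first[OF elim(1)] elim(2) \<open>U n 0 = 0\<close> by simp
      next
        case (Suc j)
        then show ?case using step[of "Suc j" n] det_p[OF elim(2)] by simp
      qed
      moreover have "n - 3 + 3 \<le> n" and n2: "n - 2 = Suc (n - 3)" using elim(1) by auto
      ultimately have "U n (n - 2) = 0 \<and> X n (n - 2) = 0" unfolding n2 by blast
      then show False using last[OF elim(1)] ab by (simp add: step_phase_def phase_def)
    qed
  qed
  \<comment> \<open>The relative factor n between \<open>u\<close> and \<open>v\<close> turns the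
    upper right entry, of order 1, and the lower left entry, of order 1 / n^2 inside a stratum, both
    into order 1 / n.\<close>
  define u where "u n j = U n j / (of_nat n * U n 0)" for n j
  define v where "v n j = X n j / U n 0" for n j
  have uv: "u n (Suc j) = transfer11 (stay (p n (Suc j)) n) (turn (p n (Suc j)) n) (link (p n (Suc j)) (1 - p n j) n)
        (link (p n (Suc j)) (1 - p n (Suc (Suc j))) n) * u n j
      + transfer12 (stay (p n (Suc j)) n) (turn (p n (Suc j)) n) (link (p n (Suc j)) (1 - p n (Suc (Suc j))) n) / of_nat n * v n j" (is "_ = ?u")
    "v n (Suc j) = of_nat n * transfer21 (stay (p n (Suc j)) n) (turn (p n (Suc j)) n) (link (p n (Suc j)) (1 - p n j) n)
        (link (p n (Suc j)) (1 - p n (Suc (Suc j))) n) * u n j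
      + transfer22 (stay (p n (Suc j)) n) (turn (p n (Suc j)) n) (link (p n (Suc j)) (1 - p n (Suc (Suc j))) n) * v n j" (is "_ = ?v")
    if "0 < j" "j + 2 < n" "?det (p n (Suc j)) (1 - p n (Suc (Suc j))) n \<noteq> 0" for n j
  proof -
    have "complex_of_nat n \<noteq> 0" using that by auto
    then show "u n (Suc j) = ?u" "v n (Suc j) = ?v"
      unfolding u_def v_def step[OF that] by (simp_all add: add_divide_distrib)
  qed
  have inv_n: "(\<lambda>n. h n / of_nat n) \<longlonglongrightarrow> 0" if "h \<longlonglongrightarrow> l" for h :: "nat \<Rightarrow> complex" and l
    using tendsto_mult[OF that of_nat_inverse_tendsto_0] by (simp add: divide_inverse)
  have cancel_n: "(\<lambda>n. of_nat n * (h n / of_nat n)) \<longlonglongrightarrow> l" if "h \<longlonglongrightarrow> l" for h :: "nat \<Rightarrow> complex" and l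
    using that by (rule Lim_transform_eventually) (use eventually_gt_at_top[of 0] in eventually_elim, simp)
  have init_u: "(\<lambda>n. u n (Suc 0)) \<longlonglongrightarrow> 0" and init_v: "(\<lambda>n. v n (Suc 0)) \<longlonglongrightarrow> 1"
  proof -
    have "(\<lambda>n. (1 / ?det a (1 - a) n) / of_nat n) \<longlonglongrightarrow> 0"
      by (rule inv_n[of _ "1 / of_real a"]) (use ab in \<open>auto intro!: tendsto_intros transfer_det_tendsto\<close>)
    moreover have "\<forall>\<^sub>F n in sequentially. (1 / ?det a (1 - a) n) / of_nat n = u n (Suc 0)"
      using large U0 by eventually_elim (use first in \<open>auto simp: u_def\<close>)
    ultimately show "(\<lambda>n. u n (Suc 0)) \<longlonglongrightarrow> 0" by (rule Lim_transform_eventually)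
    have "(\<lambda>n. turn a n / ?det a (1 - a) n) \<longlonglongrightarrow> of_real a / of_real a"
      using ab by (intro tendsto_intros transfer_det_tendsto turn_tendsto) auto
    moreover have "\<forall>\<^sub>F n in sequentially. turn a n / ?det a (1 - a) n = v n (Suc 0)"
      using large U0 by eventually_elim (use first in \<open>auto simp: v_def\<close>)
    ultimately show "(\<lambda>n. v n (Suc 0)) \<longlonglongrightarrow> 1"
      using ab by (auto dest: Lim_transform_eventually)
  qed
  let ?na = "t\<^sup>2 * a * (1 - a + (1 - b)\<^sup>2 - 2 * (1 - a) * (1 - b)) / ((1 - a) * (1 - b)\<^sup>2)"
  let ?nb = "t\<^sup>2 * b * (1 - b + (1 - a)\<^sup>2 - 2 * (1 - b) * (1 - a)) / ((1 - b) * (1 - a)\<^sup>2)"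
  define Sa Ca Sb Cb where "Sa = ga * sinhc \<omega>a \<eta>" and "Ca = cosh (\<omega>a * \<eta>)"
    and "Sb = gb * sinhc \<omega>b (1 - \<eta>)" and "Cb = cosh (\<omega>b * (1 - \<eta>))"
  \<comment> \<open>Step \<open>j\<close> involves the sites j, j + 1, j + 2. They all lie in the
    inner stratum for j from 1 to f - 3, so the first rotation ends at index f - 2.\<close>
  have Ja: "(\<lambda>n. real (f n - 3) / real n) \<longlonglongrightarrow> \<eta>"
  proof -
    have "(\<lambda>n. real (f n) / real n - 3 / real n) \<longlonglongrightarrow> \<eta> - 0"
      by (intro tendsto_diff f) real_asymp
    moreover have "\<forall>\<^sub>F n in sequentially. real (f n) / real n - 3 / real n = real (f n - 3) / real n"
      using large by eventually_elim (simp add: of_nat_diff diff_divide_distrib)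
    ultimately show ?thesis by (auto dest: Lim_transform_eventually)
  qed
  have Jb: "(\<lambda>n. real (n - 2 - f n) / real n) \<longlonglongrightarrow> 1 - \<eta>"
  proof -
    have "(\<lambda>n. 1 - 2 / real n - real (f n) / real n) \<longlonglongrightarrow> 1 - 0 - \<eta>"
      by (intro tendsto_diff f tendsto_const) real_asymp
    moreover have "\<forall>\<^sub>F n in sequentially. 1 - 2 / real n - real (f n) / real n = real (n - 2 - f n) / real n"
      using large by eventually_elim (auto simp: of_nat_diff diff_divide_distrib add_divide_distrib)
    ultimately show ?thesis by (auto dest: Lim_transform_eventually)
  qed
  note a_lims = transfer11_diag_first_order[OF ab(1,2) b0 c] cancel_n[OF transfer12_tendsto[OF ab(1)]]
    transfer21_second_order[OF ab(1,2) b0 c] transfer22_diag_first_order[OF ab(1,2) b0 c]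
  note b_lims = transfer11_diag_first_order[OF ab(3,4) a0 cb] cancel_n[OF transfer12_tendsto[OF ab(3)]]
    transfer21_second_order[OF ab(3,4) a0 cb] transfer22_diag_first_order[OF ab(3,4) a0 cb]
  have gca: "complex_of_real ((1 - a) / a) * of_real ?na = of_real (\<omega>a\<^sup>2)"
    and gcb: "complex_of_real ((1 - b) / b) * of_real ?nb = of_real (\<omega>b\<^sup>2)"
    unfolding of_real_mult[symmetric] \<omega>a \<omega>b using ab by (simp_all add: divide_simps)
  have ua: "\<forall>\<^sub>F n in sequentially. \<forall>j<f n - 3. u n (Suc (Suc j)) =
      transfer11 (stay a n) (turn a n) (link a (1 - a) n) (link a (1 - a) n) * u n (Suc j)
      + transfer12 (stay a n) (turn a n) (link a (1 - a) n) / of_nat n * v n (Suc j)"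
    and va: "\<forall>\<^sub>F n in sequentially. \<forall>j<f n - 3. v n (Suc (Suc j)) =
      of_nat n * transfer21 (stay a n) (turn a n) (link a (1 - a) n) (link a (1 - a) n) * u n (Suc j)
      + transfer22 (stay a n) (turn a n) (link a (1 - a) n) * v n (Suc j)"
    using large det
    by (eventually_elim; use uv[of "Suc _"] in \<open>force simp: p_def persist_def\<close>)+
  have 1: "(\<lambda>n. u n (Suc (f n - 3))) \<longlonglongrightarrow> of_real Sa" "(\<lambda>n. v n (Suc (f n - 3))) \<longlonglongrightarrow> of_real Ca"
    using hyperbolic_recursion_limit[OF order_refl Ja a_lims gca, where u = "\<lambda>n j. u n (Suc j)" and v = "\<lambda>n j. v n (Suc j)",
      OF ua va init_u init_v]
    by (simp_all add: Sa_def Ca_def ga_def)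
  have 2: "(\<lambda>n. u n (f n - 2)) \<longlonglongrightarrow> of_real Sa" "(\<lambda>n. v n (f n - 2)) \<longlonglongrightarrow> of_real Ca"
    by (rule Lim_transform_eventually[OF 1(1)] Lim_transform_eventually[OF 1(2)],
        use large in eventually_elim, simp add: Suc_diff_le numeral_3_eq_3 numeral_2_eq_2 Suc_diff_Suc)+
  \<comment> \<open>Site f - 1 is inner with an outer right neighbour: n times its lower left entry
    tends to i a (a - b) t c2, while the first component keeps its limit.\<close>
  have 3: "(\<lambda>n. u n (f n - 1)) \<longlonglongrightarrow> of_real Sa"
    "(\<lambda>n. v n (f n - 1)) \<longlonglongrightarrow> \<i> * of_real (a * (a - b) * (t * c2)) * of_real Sa + of_real Ca"
  proof -
    have "(\<lambda>n. transfer11 (stay a n) (turn a n) (link a (1 - a) n) (link a (1 - b) n) * u n (f n - 2)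
        + transfer12 (stay a n) (turn a n) (link a (1 - b) n) / of_nat n * v n (f n - 2)) \<longlonglongrightarrow> 1 * of_real Sa + 0 * of_real Ca"
      using ab by (intro tendsto_intros 2 transfer11_tendsto inv_n[OF transfer12_tendsto]) auto
    moreover have "\<forall>\<^sub>F n in sequentially. transfer11 (stay a n) (turn a n) (link a (1 - a) n) (link a (1 - b) n) * u n (f n - 2)
        + transfer12 (stay a n) (turn a n) (link a (1 - b) n) / of_nat n * v n (f n - 2) = u n (f n - 1)"
      using large det
    proof eventually_elim
      case (elim n)
      then have S: "Suc (f n - 2) = f n - 1" "Suc (f n - 1) = f n"
        and p: "p n (f n - 2) = a" "p n (f n - 1) = a" "p n (f n) = b"
        by (auto simp: p_def persist_def)
      have "0 < f n - 2" "f n - 2 + 2 < n" using elim by auto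
      from uv(1)[of "f n - 2" n, unfolded S p, OF this] elim show ?case by simp
    qed
    ultimately show "(\<lambda>n. u n (f n - 1)) \<longlonglongrightarrow> of_real Sa" by (auto dest: Lim_transform_eventually)
    have "(\<lambda>n. of_nat n * transfer21 (stay a n) (turn a n) (link a (1 - a) n) (link a (1 - b) n) * u n (f n - 2)
        + transfer22 (stay a n) (turn a n) (link a (1 - b) n) * v n (f n - 2)) \<longlonglongrightarrow>
        \<i> * of_real (a * (1 - a + (1 - b) - 2 * (1 - a)) * (t * c2)) * of_real Sa + 1 * of_real Ca"
      by (intro tendsto_add tendsto_mult[OF transfer21_first_order[OF ab(1,2) b0 c] 2(1)] tendsto_mult[OF transfer22_tendsto[OF ab(1)] 2(2)])
    moreover have "\<forall>\<^sub>F n in sequentially. of_nat n * transfer21 (stay a n) (turn a n) (link a (1 - a) n) (link a (1 - b) n) * u n (f n - 2)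
        + transfer22 (stay a n) (turn a n) (link a (1 - b) n) * v n (f n - 2) = v n (f n - 1)"
      using large det
    proof eventually_elim
      case (elim n)
      then have S: "Suc (f n - 2) = f n - 1" "Suc (f n - 1) = f n"
        and p: "p n (f n - 2) = a" "p n (f n - 1) = a" "p n (f n) = b"
        by (auto simp: p_def persist_def)
      have "0 < f n - 2" "f n - 2 + 2 < n" using elim by auto
      from uv(2)[of "f n - 2" n, unfolded S p, OF this] elim show ?case by simp
    qed
    ultimately have "(\<lambda>n. v n (f n - 1)) \<longlonglongrightarrow> \<i> * of_real (a * (1 - a + (1 - b) - 2 * (1 - a)) * (t * c2)) * of_real Sa + 1 * of_real Ca"
      by (rule Lim_transform_eventually)
    moreover have "1 - a + (1 - b) - 2 * (1 - a) = a - b" by simp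
    ultimately show "(\<lambda>n. v n (f n - 1)) \<longlonglongrightarrow> \<i> * of_real (a * (a - b) * (t * c2)) * of_real Sa + of_real Ca"
      by (simp only: mult_1)
  qed
  \<comment> \<open>The contributions a (a - b) of site f - 1 and b (b - a) of site f add up to (a -
    b)^2.\<close>
  define W where "W = \<i> * of_real (t * c2 * (a - b)\<^sup>2 * Sa) + complex_of_real Ca"
  have 4: "(\<lambda>n. u n (f n)) \<longlonglongrightarrow> of_real Sa" "(\<lambda>n. v n (f n)) \<longlonglongrightarrow> W"
  proof -
    have "(\<lambda>n. transfer11 (stay b n) (turn b n) (link b (1 - a) n) (link b (1 - b) n) * u n (f n - 1)
        + transfer12 (stay b n) (turn b n) (link b (1 - b) n) / of_nat n * v n (f n - 1)) \<longlonglongrightarrow>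
        1 * of_real Sa + 0 * (\<i> * of_real (a * (a - b) * (t * c2)) * of_real Sa + of_real Ca)"
      by (intro tendsto_add tendsto_mult[OF transfer11_tendsto[OF ab(3)] 3(1)] tendsto_mult[OF inv_n[OF transfer12_tendsto[OF ab(3)]] 3(2)])
    moreover have "\<forall>\<^sub>F n in sequentially. transfer11 (stay b n) (turn b n) (link b (1 - a) n) (link b (1 - b) n) * u n (f n - 1)
        + transfer12 (stay b n) (turn b n) (link b (1 - b) n) / of_nat n * v n (f n - 1) = u n (f n)"
      using large det
    proof eventually_elim
      case (elim n)
      then have S: "Suc (f n - 1) = f n"
        and p: "p n (f n - 1) = a" "p n (f n) = b" "p n (Suc (f n)) = b"
        by (auto simp: p_def persist_def)
      have "0 < f n - 1" "f n - 1 + 2 < n" using elim by auto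
      from uv(1)[of "f n - 1" n, unfolded S p, OF this] elim show ?case by simp
    qed
    ultimately show "(\<lambda>n. u n (f n)) \<longlonglongrightarrow> of_real Sa" by (auto dest: Lim_transform_eventually)
    have "(\<lambda>n. of_nat n * transfer21 (stay b n) (turn b n) (link b (1 - a) n) (link b (1 - b) n) * u n (f n - 1)
        + transfer22 (stay b n) (turn b n) (link b (1 - b) n) * v n (f n - 1)) \<longlonglongrightarrow>
        \<i> * of_real (b * (1 - a + (1 - b) - 2 * (1 - b)) * (t * c2)) * of_real Sa +
        1 * (\<i> * of_real (a * (a - b) * (t * c2)) * of_real Sa + of_real Ca)" (is "_ \<longlonglongrightarrow> ?W")
      by (intro tendsto_add tendsto_mult[OF transfer21_first_order[OF ab(3,4) a0 cb] 3(1)] tendsto_mult[OF transfer22_tendsto[OF ab(3)] 3(2)])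
    moreover have "\<forall>\<^sub>F n in sequentially. of_nat n * transfer21 (stay b n) (turn b n) (link b (1 - a) n) (link b (1 - b) n) * u n (f n - 1)
        + transfer22 (stay b n) (turn b n) (link b (1 - b) n) * v n (f n - 1) = v n (f n)"
      using large det
    proof eventually_elim
      case (elim n)
      then have S: "Suc (f n - 1) = f n"
        and p: "p n (f n - 1) = a" "p n (f n) = b" "p n (Suc (f n)) = b"
        by (auto simp: p_def persist_def)
      have "0 < f n - 1" "f n - 1 + 2 < n" using elim by auto
      from uv(2)[of "f n - 1" n, unfolded S p, OF this] elim show ?case by simp
    qed
    ultimately have "(\<lambda>n. v n (f n)) \<longlonglongrightarrow> ?W" by (rule Lim_transform_eventually)
    moreover have "?W = W" by (simp add: W_def algebra_simps power2_eq_square)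
    ultimately show "(\<lambda>n. v n (f n)) \<longlonglongrightarrow> W" by (simp only:)
  qed
  have ub: "\<forall>\<^sub>F n in sequentially. \<forall>j<n - 2 - f n. u n (f n + Suc j) =
      transfer11 (stay b n) (turn b n) (link b (1 - b) n) (link b (1 - b) n) * u n (f n + j)
      + transfer12 (stay b n) (turn b n) (link b (1 - b) n) / of_nat n * v n (f n + j)"
    and vb: "\<forall>\<^sub>F n in sequentially. \<forall>j<n - 2 - f n. v n (f n + Suc j) =
      of_nat n * transfer21 (stay b n) (turn b n) (link b (1 - b) n) (link b (1 - b) n) * u n (f n + j)
      + transfer22 (stay b n) (turn b n) (link b (1 - b) n) * v n (f n + j)"
    using large det
    by (eventually_elim; use uv[of "f _ + _"] in \<open>force simp: p_def persist_def\<close>)+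
  have 5: "(\<lambda>n. u n (f n + (n - 2 - f n))) \<longlonglongrightarrow> of_real Cb * of_real Sa + of_real Sb * W"
    "(\<lambda>n. v n (f n + (n - 2 - f n))) \<longlonglongrightarrow> of_real ?nb * of_real (sinhc \<omega>b (1 - \<eta>)) * of_real Sa + of_real Cb * W"
    using hyperbolic_recursion_limit[OF order_refl Jb b_lims gcb, where u = "\<lambda>n j. u n (f n + j)" and v = "\<lambda>n j. v n (f n + j)"
      and ?u0.0 = "of_real Sa" and ?v0.0 = W, OF ub vb] 4
    by (simp_all add: Sb_def Cb_def gb_def)
  \<comment> \<open>The terminal condition divided by \<open>of_nat n * U n 0\<close>. Its left side
    has a known limit, and the second component enters only with a factor 1 / n, so the scale of the
    shot can be read off.\<close>
  have "(\<lambda>n. turn b n * u n (f n + (n - 2 - f n)) + (1 - turn b n) * (v n (f n + (n - 2 - f n)) / of_nat n)) \<longlonglongrightarrow>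
    of_real b * (of_real Cb * of_real Sa + of_real Sb * W) + (1 - of_real b) * 0"
    by (intro tendsto_intros turn_tendsto 5(1) inv_n[OF 5(2)])
  moreover have "\<forall>\<^sub>F n in sequentially. turn b n * u n (f n + (n - 2 - f n)) + (1 - turn b n) * (v n (f n + (n - 2 - f n)) / of_nat n)
      = (step_phase n)\<^sup>2 * of_real b / (of_nat n * U n 0)"
    using large U0
  proof eventually_elim
    case (elim n)
    then have "f n + (n - 2 - f n) = n - 2" by simp
    then show ?case unfolding last[OF elim(1), symmetric] u_def v_def using elim
      by (simp add: field_simps)
  qed
  moreover have "of_real Cb * of_real Sa + of_real Sb * W = L"
    by (simp add: L_def W_def Sa_def Sb_def Ca_def Cb_def algebra_simps)
  ultimately have "(\<lambda>n. (step_phase n)\<^sup>2 * of_real b / (of_nat n * U n 0)) \<longlonglongrightarrow> of_real b * L"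
    by (auto dest: Lim_transform_eventually)
  then have "(\<lambda>n. (step_phase n)\<^sup>2 * of_real b / ((step_phase n)\<^sup>2 * of_real b / (of_nat n * U n 0))) \<longlonglongrightarrow> 1\<^sup>2 * of_real b / (of_real b * L)"
    using L ab by (intro tendsto_intros step_phase_tendsto) auto
  moreover have "(step_phase n)\<^sup>2 * of_real b \<noteq> 0" for n
    using ab by (simp add: step_phase_def phase_def)
  ultimately show ?thesis using ab by simp
qed

end

section \<open>The limit law\<close>

abbreviation strata :: "real \<Rightarrow> real \<Rightarrow> nat \<Rightarrow> int \<Rightarrow> real" where
  "strata a b f k \<equiv> persist a b f (nat \<bar>k\<bar>)"

lemma persistent_walk_strata:
  assumes "0 < a" "a < 1" "0 < b" "b < 1"
  shows "persistent_walk (strata a b f) (min (min a (1 - a)) (min b (1 - b)))"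
  by unfold_locales (use assms in \<open>auto simp: persist_def\<close>)

lemma path_prob_Cons:
  assumes "\<bar>m\<bar> < int N" "persistent_walk (strata a b f) \<rho>"
  shows "path_prob a b f N m (s # ss) = persistent_walk.path_weight (strata a b f) N (m + step_val s) s ss / 2"
proof -
  interpret persistent_walk "strata a b f" N \<rho> by (rule assms(2))
  have stop: "(\<forall>j<length (s # ss). \<bar>pos m (s # ss) j\<bar> < int N) \<and> \<bar>pos m (s # ss) (length (s # ss))\<bar> = int N \<longleftrightarrow>
    (\<forall>j<length ss. \<bar>pos (m + step_val s) ss j\<bar> < int N) \<and> \<bar>pos (m + step_val s) ss (length ss)\<bar> = int N"
    using assms(1) by (simp add: All_less_Suc2 pos_Cons_Suc)
  have steps: "(\<Prod>j\<in>{1..<length (s # ss)}. let \<alpha> = strata a b f (pos m (s # ss) j)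
      in if (s # ss) ! j = (s # ss) ! (j - 1) then \<alpha> else 1 - \<alpha>) =
    (\<Prod>j<length ss. trans_prob (pos (m + step_val s) ss j) ((s # ss) ! j) (ss ! j))"
    by (auto simp: prod.shift_bounds_Suc_ivl lessThan_atLeast0 pos_Cons_Suc trans_prob_def Let_def simp del: prod.op_ivl_Suc intro!: prod.cong)
  show ?thesis
    unfolding path_prob_def path_weight_eq_prod stop steps by auto
qed

lemma phase_power: "phase x n ^ k = phase (real k * x) n"
  by (simp add: phase_def Complex.DeMoivre)

lemma exp_XN:
  fixes a b :: real
  defines "c1 \<equiv> 1 / (1 - a) + 1 / (1 - b)" and "c2 \<equiv> 1 / ((1 - a) * (1 - b))"
  assumes "a < 1" "b < 1"
  shows "exp (\<i> * complex_of_real (t * XN a b n m ss)) =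
    path_stat (phase t n) (phase (- t * c1) n) (phase (t * c2) n) (meander m ss)"
proof -
  have c1: "(2 - a - b) / ((1 - a) * (1 - b)) = c1"
    using assms(3,4) by (simp add: c1_def field_simps)
  show ?thesis
    unfolding path_stat_def phase_power phase_mult unfolding XN_def Let_def c1 c2_def[symmetric] phase_def cis_conv_exp
    by (simp add: algebra_simps)
qed

lemma charfun_XN_eq_start_sum:
  fixes a b \<eta> :: real and n :: nat
  defines "c1 \<equiv> 1 / (1 - a) + 1 / (1 - b)" and "c2 \<equiv> 1 / ((1 - a) * (1 - b))"
    and "\<alpha> \<equiv> strata a b (nat \<lfloor>\<eta> * real n\<rfloor>)"
  assumes ab: "a < 1" "b < 1" and m: "\<bar>m\<bar> < int n" and walk: "persistent_walk \<alpha> \<rho>"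
  shows "charfun_XN a b \<eta> m n t =
    persistent_walk.start_sum \<alpha> n m (path_stat (phase t n) (phase (- t * c1) n) (phase (t * c2) n))"
proof -
  interpret persistent_walk \<alpha> n \<rho> by (rule walk)
  let ?g = "path_stat (phase t n) (phase (- t * c1) n) (phase (t * c2) n)"
  let ?f = "nat \<lfloor>\<eta> * real n\<rfloor>"
  have "((\<lambda>ss. complex_of_real (path_prob a b ?f n m (s # ss)) * ?g (meander m (s # ss))) has_sum
      path_sum (m + step_val s) s (\<lambda>ss. ?g (meander m (s # ss))) / 2) UNIV" for s
  proof -
    have "((\<lambda>ss. path_weight (m + step_val s) s ss *\<^sub>R ?g (meander m (s # ss))) has_sum
      path_sum (m + step_val s) s (\<lambda>ss. ?g (meander m (s # ss)))) UNIV"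
      unfolding path_sum_def by (rule has_sum_infsum[OF path_sum_summable[of _ 1]]) (simp add: norm_path_stat)
    from has_sum_cmult_right[OF this, of "1 / 2"] show ?thesis
      unfolding path_prob_Cons[OF m walk[unfolded \<alpha>_def]] \<alpha>_def[symmetric]
      by (simp add: scaleR_conv_of_real)
  qed
  from infsumI[OF has_sum_bool_list[OF this[of True] this[of False]]]
  have "(\<Sum>\<^sub>\<infinity>ss. complex_of_real (path_prob a b ?f n m ss) * ?g (meander m ss)) = start_sum m ?g"
    by (simp add: start_sum_def UNIV_bool path_prob_def add_divide_distrib add.commute)
  then show ?thesis
    unfolding charfun_XN_def Let_def exp_XN[OF ab] c1_def c2_def .
qed

lemma floor_ratio_limit:
  assumes "0 < \<eta>"
  shows "(\<lambda>n. real (nat \<lfloor>\<eta> * real n\<rfloor>) / real n) \<longlonglongrightarrow> \<eta>"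
proof (rule tendsto_sandwich)
  show "(\<lambda>n. \<eta> - 1 / real n) \<longlonglongrightarrow> \<eta>" by real_asymp
  show "(\<lambda>_. \<eta>) \<longlonglongrightarrow> \<eta>" by simp
  have "\<eta> * real n - 1 \<le> real (nat \<lfloor>\<eta> * real n\<rfloor>)" "real (nat \<lfloor>\<eta> * real n\<rfloor>) \<le> \<eta> * real n" for n
    using assms by (auto simp: of_nat_nat)
  note bounds = this
  show "\<forall>\<^sub>F n in sequentially. \<eta> - 1 / real n \<le> real (nat \<lfloor>\<eta> * real n\<rfloor>) / real n"
    using eventually_gt_at_top[of 0]
  proof eventually_elim
    case (elim n)
    with divide_right_mono[OF bounds(1)[of n], of "real n"] show ?case by (simp add: diff_divide_distrib)
  qed
  show "\<forall>\<^sub>F n in sequentially. real (nat \<lfloor>\<eta> * real n\<rfloor>) / real n \<le> \<eta>"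
    using eventually_gt_at_top[of 0] by eventually_elim (use bounds(2) in \<open>simp add: field_simps\<close>)
qed

text \<open>The constant \<open>L\<close> of \<open>two_strata_limit\<close> for the parameters of
  the theorem. Its value at t = 0 becomes the normalization of the limit.\<close>

definition limit_denom :: "real \<Rightarrow> real \<Rightarrow> real \<Rightarrow> real \<Rightarrow> complex" where
  "limit_denom a b \<eta> t =
    (let \<omega>a = t * sqrt (a + b\<^sup>2 - 2 * a * b) / (1 - b); \<omega>b = t * sqrt (b + a\<^sup>2 - 2 * a * b) / (1 - a);
         Sa = (1 - a) / a * sinhc \<omega>a \<eta>; Sb = (1 - b) / b * sinhc \<omega>b (1 - \<eta>)
     in complex_of_real (cosh (\<omega>b * (1 - \<eta>)) * Sa + Sb * cosh (\<omega>a * \<eta>))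
       + \<i> * of_real (Sb * (t * (1 / ((1 - a) * (1 - b))) * (a - b)\<^sup>2 * Sa)))"

lemma sinhc_pos: "0 < x \<Longrightarrow> 0 < sinhc \<omega> x"
  by (cases "0 < \<omega>") (auto simp: sinhc_def mult_neg_pos divide_neg_neg)

lemma limit_denom_nonzero:
  assumes "0 < a" "a < 1" "0 < b" "b < 1" "0 < \<eta>" "\<eta> < 1"
  shows "limit_denom a b \<eta> t \<noteq> 0"
proof -
  have "0 < Re (limit_denom a b \<eta> t)"
    unfolding limit_denom_def Let_def using assms
    by (auto intro!: add_pos_pos mult_pos_pos divide_pos_pos sinhc_pos)
  then show ?thesis by auto
qed

lemma variance_pos: "0 < a + b\<^sup>2 - 2 * a * b" if "0 < a" "a < 1" for a b :: real
proof -
  have "a + b\<^sup>2 - 2 * a * b = a * (1 - a) + (a - b)\<^sup>2" by (simp add: power2_eq_square algebra_simps)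
  then show ?thesis using that by (simp add: add_pos_nonneg)
qed

lemma excursion_sum_limit:
  fixes a b \<eta> t :: real
  defines "c1 \<equiv> 1 / (1 - a) + 1 / (1 - b)" and "c2 \<equiv> 1 / ((1 - a) * (1 - b))"
    and "f \<equiv> \<lambda>n. nat \<lfloor>\<eta> * real n\<rfloor>"
  assumes ab: "0 < a" "a < 1" "0 < b" "b < 1" and \<eta>: "0 < \<eta>" "\<eta> < 1"
  shows "(\<lambda>n. of_nat n * persistent_walk.excursion_sum (strata a b (f n)) n
      (path_stat (phase t n) (phase (- t * c1) n) (phase (t * c2) n))) \<longlonglongrightarrow> 1 / limit_denom a b \<eta> t"
proof -
  interpret phase_weights t c1 c2 .
  note walk = persistent_walk_strata[OF ab]
  define V where "V n = persistent_walk.avoid_sum (strata a b (f n)) n (step_phase n) (run_phase n) (short_phase n) True" for n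
  \<comment> \<open>\<open>U n j\<close> and \<open>D n (Suc j)\<close> belong to a run that starts
    with the edge between j and j + 1, crossed upward or downward; the factor
    \<open>step_phase n\<close> accounts for that crossing.\<close>
  define U where "U n j = step_phase n * V n (int j + 1) True" for n j
  define D where "D n j = step_phase n * V n (int j - 1) False" for n j
  have norms: "norm (step_phase n) = 1" "norm (run_phase n) = 1" "norm (short_phase n) = 1" for n
    by (simp_all add: step_phase_def run_phase_def short_phase_def)
  have lim: "(\<lambda>n. of_nat n * U n 0) \<longlonglongrightarrow> 1 / limit_denom a b \<eta> t"
    unfolding limit_denom_def Let_def c2_def[symmetric]
  proof (rule two_strata_limit[where f = f and D = D and U = U, OF ab])
    show "c1 = 1 / (1 - a) + 1 / (1 - b)" "c2 = 1 / ((1 - a) * (1 - b))" by (simp_all add: c1_def c2_def)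
    show "(\<lambda>n. real (f n) / real n) \<longlonglongrightarrow> \<eta>" unfolding f_def by (rule floor_ratio_limit[OF \<eta>(1)])
    show "(t * sqrt (a + b\<^sup>2 - 2 * a * b) / (1 - b))\<^sup>2 = t\<^sup>2 * (1 - a + (1 - b)\<^sup>2 - 2 * (1 - a) * (1 - b)) / (1 - b)\<^sup>2"
      "(t * sqrt (b + a\<^sup>2 - 2 * a * b) / (1 - a))\<^sup>2 = t\<^sup>2 * (1 - b + (1 - a)\<^sup>2 - 2 * (1 - b) * (1 - a)) / (1 - a)\<^sup>2"
      using variance_pos[OF ab(1,2), of b] variance_pos[OF ab(3,4), of a]
      by (simp_all add: power_divide power_mult_distrib mult.commute[of b a]) (simp_all add: power2_eq_square algebra_simps)
  next
    fix n j :: nat assume "j + 2 < n"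
    from persistent_walk.avoid_sum_up[OF walk[of "f n"] norms[of n] this, THEN arg_cong, of "(*) (step_phase n)"]
    show "U n j = stay (persist a b (f n) (Suc j)) n * U n (Suc j)
      - (stay (persist a b (f n) (Suc j)) n - link (persist a b (f n) (Suc j)) (1 - persist a b (f n) (Suc (Suc j))) n) * D n (Suc (Suc j))
      + (1 - turn (persist a b (f n) (Suc j)) n) * D n (Suc j)"
      unfolding U_def D_def V_def stay_def link_def turn_def by (simp add: algebra_simps nat_add_distrib)
  next
    fix n j :: nat assume "0 < j" "j + 1 < n"
    from persistent_walk.avoid_sum_down[OF walk[of "f n"] norms[of n] this, THEN arg_cong, of "(*) (step_phase n)"]
    show "D n (Suc (Suc j)) = stay (persist a b (f n) (Suc j)) n * D n (Suc j)
      - (stay (persist a b (f n) (Suc j)) n - link (persist a b (f n) (Suc j)) (1 - persist a b (f n) j) n) * U n j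
      + (1 - turn (persist a b (f n) (Suc j)) n) * U n (Suc j)"
      unfolding U_def D_def V_def stay_def link_def turn_def by (simp add: algebra_simps nat_add_distrib)
  next
    fix n :: nat assume n: "2 < n"
    show "D n 1 = 0"
      using persistent_walk.avoid_sum_0[OF walk[of "f n"] norms[of n]] by (simp add: D_def V_def)
    from persistent_walk.avoid_sum_down_1[OF walk[of "f n"] norms[of n] n, THEN arg_cong, of "(*) (step_phase n)"]
    show "D n 2 = (1 - turn (persist a b (f n) 1) n) * U n 1"
      unfolding U_def D_def V_def turn_def by (simp add: algebra_simps)
    have "nat \<bar>int n - 1\<bar> = n - 1" "int (n - 2) + 1 = int n - 1" "int (n - 1) - 1 = int n - 2"
      using n by auto
    with persistent_walk.avoid_sum_last[OF walk[of "f n"] norms[of n] n, THEN arg_cong, of "(*) (step_phase n)"]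
    show "U n (n - 2) - (1 - turn (persist a b (f n) (n - 1)) n) * D n (n - 1) = (step_phase n)\<^sup>2 * of_real (persist a b (f n) (n - 1))"
      unfolding U_def D_def V_def turn_def by (simp add: algebra_simps power2_eq_square)
  next
    show "complex_of_real (cosh (t * sqrt (b + a\<^sup>2 - 2 * a * b) / (1 - a) * (1 - \<eta>)) * ((1 - a) / a * sinhc (t * sqrt (a + b\<^sup>2 - 2 * a * b) / (1 - b)) \<eta>)
      + (1 - b) / b * sinhc (t * sqrt (b + a\<^sup>2 - 2 * a * b) / (1 - a)) (1 - \<eta>) * cosh (t * sqrt (a + b\<^sup>2 - 2 * a * b) / (1 - b) * \<eta>))
      + \<i> * of_real ((1 - b) / b * sinhc (t * sqrt (b + a\<^sup>2 - 2 * a * b) / (1 - a)) (1 - \<eta>)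
        * (t * c2 * (a - b)\<^sup>2 * ((1 - a) / a * sinhc (t * sqrt (a + b\<^sup>2 - 2 * a * b) / (1 - b)) \<eta>))) \<noteq> 0"
      using limit_denom_nonzero[OF ab \<eta>] unfolding limit_denom_def Let_def c2_def .
  qed (use \<eta> in auto)
  have "persistent_walk.excursion_sum (strata a b (f n)) n
      (path_stat (phase t n) (phase (- t * c1) n) (phase (t * c2) n)) = run_phase n * U n 0" for n
    using persistent_walk.excursion_sum_path_stat[OF walk[of "f n"] norms[of n]]
    by (simp add: step_phase_def run_phase_def short_phase_def U_def V_def)
  then show ?thesis
    using tendsto_mult[OF run_phase_tendsto lim] by (simp add: mult_ac)
qed

text \<open>For nonzero \<open>t\<close> the common factor \<open>K\<close> turns the numerator and
  the denominator of \<open>phi_hat\<close> into values of \<open>limit_denom\<close>. The ratio is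
  the form in which the quotient of excursion sums converges.\<close>

lemma phi_hat_eq:
  assumes ab: "0 < a" "a < 1" "0 < b" "b < 1" and \<eta>: "0 < \<eta>" "\<eta> < 1"
  shows "phi_hat a b \<eta> t = limit_denom a b \<eta> 0 / limit_denom a b \<eta> t"
proof (cases "t = 0")
  case True
  then show ?thesis using limit_denom_nonzero[OF assms, of 0] by (simp add: phi_hat_def)
next
  case False
  define s1 s2 where "s1 = sqrt (a + b\<^sup>2 - 2 * a * b)" and "s2 = sqrt (b + a\<^sup>2 - 2 * a * b)"
  have pos: "0 < s1" "0 < s2"
    using variance_pos[OF ab(1,2), of b] variance_pos[OF ab(3,4), of a] by (simp_all add: s1_def s2_def mult_ac)
  define k1 k2 where "k1 = \<eta> * s1 / (1 - b)" and "k2 = (1 - \<eta>) * s2 / (1 - a)"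
  define c1 h1 c2 h2 where "c1 = cosh (k1 * t)" and "h1 = sinh (k1 * t)" and "c2 = cosh (k2 * t)" and "h2 = sinh (k2 * t)"
  define K where "K = a * b * s1 * s2 * t / ((1 - a) * (1 - b))"
  have K: "K \<noteq> 0" using ab pos False by (simp add: K_def)
  have q: "1 - a \<noteq> 0" "1 - b \<noteq> 0" using ab by auto
  have k1: "t * s1 / (1 - b) * \<eta> = k1 * t" and k2: "t * s2 / (1 - a) * (1 - \<eta>) = k2 * t"
    by (simp_all add: k1_def k2_def mult_ac)
  have S1: "sinhc (t * s1 / (1 - b)) \<eta> = h1 * (1 - b) / (t * s1)"
    and S2: "sinhc (t * s2 / (1 - a)) (1 - \<eta>) = h2 * (1 - a) / (t * s2)"
    unfolding sinhc_def k1 k2 h1_def h2_def using False pos q by simp_all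
  have zero: "complex_of_real ((b * k1 * s2 + a * k2 * s1) * t) = of_real K * limit_denom a b \<eta> 0"
  proof -
    have "(b * k1 * s2 + a * k2 * s1) * t = K * ((1 - a) / a * \<eta> + (1 - b) / b * (1 - \<eta>))"
      unfolding K_def k1_def k2_def using ab q by (simp add: divide_simps) (simp add: algebra_simps)
    then show ?thesis by (simp add: limit_denom_def Let_def sinhc_def)
  qed
  have re: "a * s1 * c1 * h2 + b * s2 * h1 * c2 =
      K * (c2 * ((1 - a) / a * (h1 * (1 - b) / (t * s1))) + (1 - b) / b * (h2 * (1 - a) / (t * s2)) * c1)"
    unfolding K_def using ab q pos False by (simp add: divide_simps) (simp add: algebra_simps)
  have im: "(b - a)\<^sup>2 * h1 * h2 = K * ((1 - b) / b * (h2 * (1 - a) / (t * s2)) *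
      (t * (1 / ((1 - a) * (1 - b))) * (a - b)\<^sup>2 * ((1 - a) / a * (h1 * (1 - b) / (t * s1)))))"
    unfolding K_def power2_commute[of b a] using ab q pos False by (simp add: divide_simps)
  have denom: "complex_of_real (a * s1 * c1 * h2 + b * s2 * h1 * c2) + \<i> * of_real ((b - a)\<^sup>2 * h1 * h2) =
      of_real K * limit_denom a b \<eta> t"
    unfolding re im limit_denom_def Let_def s1_def[symmetric] s2_def[symmetric] k1 k2 S1 S2
      c1_def[symmetric] c2_def[symmetric] of_real_mult[of K] by (simp only: distrib_left mult.left_commute)
  have "phi_hat a b \<eta> t = of_real ((b * k1 * s2 + a * k2 * s1) * t) /
      (complex_of_real (a * s1 * c1 * h2 + b * s2 * h1 * c2) + \<i> * of_real ((b - a)\<^sup>2 * h1 * h2))"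
    unfolding phi_hat_def Let_def s1_def[symmetric] s2_def[symmetric] k1_def[symmetric] k2_def[symmetric]
      c1_def[symmetric] c2_def[symmetric] h1_def[symmetric] h2_def[symmetric] using False by simp
  then show ?thesis unfolding zero denom using K by simp
qed

lemma start_sum_limit:
  fixes a b \<eta> t :: real and m :: int
  defines "c1 \<equiv> 1 / (1 - a) + 1 / (1 - b)" and "c2 \<equiv> 1 / ((1 - a) * (1 - b))"
    and "f \<equiv> \<lambda>n. nat \<lfloor>\<eta> * real n\<rfloor>"
  assumes ab: "0 < a" "a < 1" "0 < b" "b < 1" and \<eta>: "0 < \<eta>" "\<eta> < 1"
  shows "(\<lambda>n. persistent_walk.start_sum (strata a b (f n)) n m
      (path_stat (phase t n) (phase (- t * c1) n) (phase (t * c2) n))) \<longlonglongrightarrow> phi_hat a b \<eta> t"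
proof -
  let ?g = "\<lambda>n. path_stat (phase t n) (phase (- t * c1) n) (phase (t * c2) n)"
  define S where "S n = persistent_walk.start_sum (strata a b (f n)) n m (?g n)" for n
  define E where "E n = persistent_walk.excursion_sum (strata a b (f n)) n (?g n)" for n
  define E1 where "E1 n = persistent_walk.excursion_sum (strata a b (f n)) n (\<lambda>_. 1)" for n
  define M where "M n = persistent_walk.avoid_mass (strata a b (f n)) n 1 True" for n
  define \<rho> where "\<rho> = min (min a (1 - a)) (min b (1 - b))"
  have walk: "persistent_walk (strata a b f) \<rho>" for f
    unfolding \<rho>_def by (rule persistent_walk_strata[OF ab])
  have \<rho>: "0 < \<rho>" using ab by (simp add: \<rho>_def)
  have E: "(\<lambda>n. of_nat n * E n) \<longlonglongrightarrow> 1 / limit_denom a b \<eta> t"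
    unfolding E_def f_def c1_def c2_def by (rule excursion_sum_limit[OF ab \<eta>])
  \<comment> \<open>At t = 0 all phases are 1, so the excursion sum of the constant 1 is a special
    case of the same limit.\<close>
  have "path_stat 1 1 1 = (\<lambda>_. 1)" "phase 0 n = 1" for n
    by (simp_all add: path_stat_def[abs_def] phase_def)
  then have E1: "(\<lambda>n. of_nat n * E1 n) \<longlonglongrightarrow> 1 / limit_denom a b \<eta> 0"
    using excursion_sum_limit[OF ab \<eta>, of 0] by (simp add: E1_def f_def)
  have E1_M: "E1 n = of_real (M n)" for n
    unfolding E1_def M_def by (rule persistent_walk.excursion_sum_1[OF walk])
  have M_norm: "M n = norm (E1 n)" for n
    unfolding E1_M using persistent_walk.avoid_mass_nonneg[OF walk] by (simp add: M_def)
  have M0: "M \<longlonglongrightarrow> 0"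
    using tendsto_norm[OF tendsto_0_from_scaled[OF E1]] by (simp add: M_norm[abs_def])
  have nM: "(\<lambda>n. norm (of_nat n * E1 n)) \<longlonglongrightarrow> norm (1 / limit_denom a b \<eta> 0)"
    by (rule tendsto_norm[OF E1])
  let ?K = "\<rho> ^ (nat \<bar>m\<bar> + 2)"
  \<comment> \<open>Multiplied by n, the two excursion sums converge, and the remaining factor
    \<open>M n\<close> sends the error to 0.\<close>
  have "\<forall>\<^sub>F n in sequentially. norm (S n * (of_nat n * E1 n) - of_nat n * E n) \<le>
      (norm (of_nat n * E1 n) + norm (of_nat n * E n)) * M n / ?K"
    using eventually_gt_at_top[of "nat (\<bar>m\<bar> + 2)"]
  proof eventually_elim
    case (elim n)
    then have "\<bar>m\<bar> + 2 < int n" by linarith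
    from persistent_walk.start_sum_approx[OF walk this, where g = "?g n"]
    have "?K * norm (S n * E1 n - E n) \<le> (M n + norm (E n)) * M n"
      by (simp add: S_def E_def E1_def M_def path_stat_map_Not persistent_walk.norm_path_stat[OF walk])
    then have "norm (S n * E1 n - E n) \<le> (norm (E1 n) + norm (E n)) * M n / ?K"
      using \<rho> by (simp add: pos_le_divide_eq mult.commute flip: M_norm)
    then have "real n * norm (S n * E1 n - E n) \<le> real n * ((norm (E1 n) + norm (E n)) * M n / ?K)"
      by (intro mult_left_mono) auto
    moreover have "real n * norm (S n * E1 n - E n) = norm (S n * (of_nat n * E1 n) - of_nat n * E n)"
    proof -
      have "S n * (of_nat n * E1 n) - of_nat n * E n = of_nat n * (S n * E1 n - E n)" by (simp add: algebra_simps)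
      then show ?thesis by (simp add: norm_mult)
    qed
    ultimately show ?case by (simp add: norm_mult algebra_simps)
  qed
  note bound = this
  have "(\<lambda>n. (norm (of_nat n * E1 n) + norm (of_nat n * E n)) * M n / ?K) \<longlonglongrightarrow>
      (norm (1 / limit_denom a b \<eta> 0) + norm (1 / limit_denom a b \<eta> t)) * 0 / ?K"
    using \<rho> by (intro tendsto_intros nM tendsto_norm[OF E] M0) auto
  then have "(\<lambda>n. S n * (of_nat n * E1 n) - of_nat n * E n) \<longlonglongrightarrow> 0"
    unfolding mult_zero_right div_0 by (rule Lim_null_comparison[OF bound])
  from tendsto_add[OF this E] have "(\<lambda>n. S n * (of_nat n * E1 n)) \<longlonglongrightarrow> 1 / limit_denom a b \<eta> t" by simp
  note quotient = tendsto_divide[OF this E1]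
  have nz: "1 / limit_denom a b \<eta> 0 \<noteq> 0" using limit_denom_nonzero[OF ab \<eta>] by simp
  have "(\<lambda>n. S n * (of_nat n * E1 n) / (of_nat n * E1 n)) \<longlonglongrightarrow> phi_hat a b \<eta> t"
    using quotient[OF nz] by (simp add: phi_hat_eq[OF ab \<eta>] mult.commute)
  moreover have "\<forall>\<^sub>F n in sequentially. S n * (of_nat n * E1 n) / (of_nat n * E1 n) = S n"
    using tendsto_imp_eventually_ne[OF E1 nz] by eventually_elim simp
  ultimately have "S \<longlonglongrightarrow> phi_hat a b \<eta> t" by (rule Lim_transform_eventually)
  then show ?thesis by (simp add: S_def[abs_def])
qed

theorem theorem1:
  fixes a b \<eta> :: real and m :: int
  assumes "0 < a" "a < 1" "0 < b" "b < 1" "0 < \<eta>" "\<eta> < 1"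
  shows "\<forall>t::real. ((\<lambda>N. charfun_XN a b \<eta> m N t) \<longlongrightarrow> phi_hat a b \<eta> t)
            (inf at_top (principal {N::nat. \<eta> * real N \<in> \<nat>}))"
proof (intro allI tendsto_mono[OF inf_le1])
  \<comment> \<open>By \<open>inf_le1\<close> it suffices to take the limit over all N, with f the
    floor of \<eta> N, for which f / N still tends to \<eta>.\<close>
  fix t
  have "\<forall>\<^sub>F n in sequentially. \<bar>m\<bar> < int n"
    using eventually_gt_at_top[of "nat \<bar>m\<bar>"] by eventually_elim linarith
  then have "\<forall>\<^sub>F n in sequentially. persistent_walk.start_sum (strata a b (nat \<lfloor>\<eta> * real n\<rfloor>)) n m
      (path_stat (phase t n) (phase (- t * (1 / (1 - a) + 1 / (1 - b))) n) (phase (t * (1 / ((1 - a) * (1 - b)))) n))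
    = charfun_XN a b \<eta> m n t"
    by eventually_elim
       (rule charfun_XN_eq_start_sum[OF assms(2,4) _ persistent_walk_strata[OF assms(1-4)], symmetric])
  then show "(\<lambda>N. charfun_XN a b \<eta> m N t) \<longlonglongrightarrow> phi_hat a b \<eta> t"
    by (rule Lim_transform_eventually[OF start_sum_limit[OF assms]])
qed

end
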